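(* Let $G$ be the simply connected $2$-step nilpotent Lie group whose Lie algebra is $\mathcal{G}=V\oplus V'$ as defined in the context. Then there exists a subset $E$ of Lebesgue measure $0$ in $[G,G]$ such that if $\theta\in[G,G]$, $\theta\notin E$, and $\Theta$ is the cyclic subgroup of $G$ generated by $\theta$, then for the Lie group $G'=G/\Theta$ the following holds: for any automorphism $\tau$ of $G'$ the factor of $\tau$ on $G'/[G',G']$ is $\pm I$, where $I$ is the identity transformation; furthermore, the orbits of the action of $\mathrm{Aut}(G')$ on $G'$ consist of either one or two cosets of $[G',G']$ in $G'$.
   Context: $V$ is a $5$-dimensional real vector space with basis $\sigma_1,\dots,\sigma_5$; $W\subset\wedge^2V$ is the subspace spanned by $\sigma_1\wedge\sigma_4-\sigma_2\wedge\sigma_3$, $\sigma_1\wedge\sigma_5-\sigma_2\wedge\sigma_4$, $\sigma_2\wedge\sigma_5-\sigma_3\wedge\sigma_4$; $V'=(\wedge^2V)/W$; and $\mathcal{G}=V\oplus V'$ carries the Lie bracket determined by $[v_1,v_2]=v_1\wedge v_2\bmod W$ for $v_1,v_2\in V$ and $[x,y]=0$ for $x\in\mathcal{G}$, $y\in V'$. The commutator subgroup $[G,G]$ is closed and central in $G$ and is identified, via the exponential map, with the $7$-dimensional vector space $V'$; Lebesgue measure on $[G,G]$ refers to this identification. $G'/[G',G']$ is identified with the vector space $V$. $\mathrm{Aut}(G')$ is the group of continuous automorphisms of $G'$.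
   Formalization: The orbit claim is stated only for points of G' outside [G',G']: the identity is fixed by every automorphism, and for θ outside E so is every point of [G',G'], so their orbits are single points, not cosets of [G',G']. *)

theory Defs
  imports "HOL-Analysis.Analysis" "HOL-Algebra.Generated_Groups" "HOL-Algebra.Group_Action"
begin

section \<open>The exterior square of \<open>V = \<real>\<^sup>5\<close>\<close>

text \<open>\<open>V\<close> is \<open>real ^ 5\<close> with its standard basis. In the index type \<^typ>\<open>5\<close> the numeral
  \<open>5\<close> denotes the element \<open>0\<close>, so \<open>1, 2, 3, 4, 5\<close> are its five distinct elements.\<close>

abbreviation \<sigma> :: "5 \<Rightarrow> real ^ 5" where "\<sigma> i \<equiv> axis i 1"

text \<open>\<open>\<and>\<^sup>2V\<close> is realised by the antisymmetric \<open>5 \<times> 5\<close> matrices, with \<open>v \<and> w\<close> the matrix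
  \<open>v w\<^sup>T - w v\<^sup>T\<close>; the universal property is \<open>wedge2_universal\<close> below.\<close>

typedef wedge2 = "{A :: real ^ 5 ^ 5. transpose A = - A}" morphisms mat_of Abs_wedge2
  by (rule exI[of _ 0]) (simp add: transpose_def vec_eq_iff)

setup_lifting type_definition_wedge2

lemma transpose_linear:
  fixes A B :: "real ^ 'n ^ 'm"
  shows "transpose (A + B) = transpose A + transpose B"
    "transpose (A - B) = transpose A - transpose B"
    "transpose (- A) = - transpose A"
    "transpose (r *\<^sub>R A) = r *\<^sub>R transpose A"
    "transpose (0 :: real ^ 'n ^ 'm) = 0"
  by (simp_all add: transpose_def vec_eq_iff)

lemma wedge2_eqI: "mat_of a = mat_of b \<Longrightarrow> a = b"
  by (simp add: mat_of_inject)

text \<open>The inner product only serves to give \<open>\<and>\<^sup>2V\<close> its vector space topology.\<close>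

instantiation wedge2 :: real_inner
begin
lift_definition zero_wedge2 :: wedge2 is 0 by (simp add: transpose_linear)
lift_definition plus_wedge2 :: "wedge2 \<Rightarrow> wedge2 \<Rightarrow> wedge2" is "(+)"
  by (simp add: transpose_linear)
lift_definition minus_wedge2 :: "wedge2 \<Rightarrow> wedge2 \<Rightarrow> wedge2" is "(-)"
  by (simp add: transpose_linear)
lift_definition uminus_wedge2 :: "wedge2 \<Rightarrow> wedge2" is "uminus"
  by (simp add: transpose_linear)
lift_definition scaleR_wedge2 :: "real \<Rightarrow> wedge2 \<Rightarrow> wedge2" is "scaleR"
  by (simp add: transpose_linear)
definition inner_wedge2 :: "wedge2 \<Rightarrow> wedge2 \<Rightarrow> real"
  where "inner_wedge2 a b = mat_of a \<bullet> mat_of b"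
definition norm_wedge2 :: "wedge2 \<Rightarrow> real" where "norm_wedge2 a = sqrt (inner a a)"
definition sgn_wedge2 :: "wedge2 \<Rightarrow> wedge2" where "sgn_wedge2 a = inverse (norm a) *\<^sub>R a"
definition dist_wedge2 :: "wedge2 \<Rightarrow> wedge2 \<Rightarrow> real" where "dist_wedge2 a b = norm (a - b)"
definition uniformity_wedge2 :: "(wedge2 \<times> wedge2) filter"
  where "uniformity_wedge2 = (INF e\<in>{0<..}. principal {(x, y). dist x y < e})"
definition open_wedge2 :: "wedge2 set \<Rightarrow> bool"
  where "open_wedge2 U \<longleftrightarrow> (\<forall>x\<in>U. eventually (\<lambda>(x', y). x' = x \<longrightarrow> y \<in> U) uniformity)"
instance
proof
  fix a b c :: wedge2 and r s :: real
  show "a + b + c = a + (b + c)" by transfer (rule add.assoc)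
  show "a + b = b + a" by transfer (rule add.commute)
  show "0 + a = a" by transfer (rule add_0)
  show "- a + a = 0" by transfer (rule left_minus)
  show "a - b = a + - b" by transfer (rule diff_conv_add_uminus)
  show "r *\<^sub>R (a + b) = r *\<^sub>R a + r *\<^sub>R b" by transfer (rule scaleR_right_distrib)
  show "(r + s) *\<^sub>R a = r *\<^sub>R a + s *\<^sub>R a" by transfer (rule scaleR_left_distrib)
  show "r *\<^sub>R s *\<^sub>R a = (r * s) *\<^sub>R a" by transfer (rule scaleR_scaleR)
  show "1 *\<^sub>R a = a" by transfer (rule scaleR_one)
  show "inner a b = inner b a"
    unfolding inner_wedge2_def by (rule inner_commute)
  show "inner (a + b) c = inner a c + inner b c"
    unfolding inner_wedge2_def plus_wedge2.rep_eq by (rule inner_add_left)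
  show "inner (r *\<^sub>R a) b = r * inner a b"
    unfolding inner_wedge2_def scaleR_wedge2.rep_eq by (rule inner_scaleR_left)
  show "0 \<le> inner a a"
    unfolding inner_wedge2_def by (rule inner_ge_zero)
  show "inner a a = 0 \<longleftrightarrow> a = 0"
    unfolding inner_wedge2_def inner_eq_zero_iff zero_wedge2.rep_eq[symmetric] mat_of_inject ..
qed (rule norm_wedge2_def sgn_wedge2_def dist_wedge2_def uniformity_wedge2_def open_wedge2_def)+
end

lemma linear_mat_of: "linear mat_of"
  by (rule linearI) (simp_all add: plus_wedge2.rep_eq scaleR_wedge2.rep_eq)

lemma ex_euclidean_basis:
  fixes f :: "'a::real_inner \<Rightarrow> 'b::euclidean_space"
  assumes lin: "linear f" and isom: "\<And>x y. x \<bullet> y = f x \<bullet> f y" and nz: "z \<noteq> (0::'a)"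
  shows "\<exists>B::'a set. B \<noteq> {} \<and> finite B \<and> (\<forall>u\<in>B. \<forall>v\<in>B. u \<bullet> v = (if u = v then 1 else 0)) \<and>
           (\<forall>x. (\<forall>u\<in>B. x \<bullet> u = 0) \<longleftrightarrow> x = 0)"
proof -
  have "x = 0" if "f x = 0" for x
    using isom[of x x] that by simp
  then have inj: "inj f"
    by (simp add: linear_injective_0[OF lin])
  have "subspace (range f)" by (simp add: lin linear_subspace_image)
  then have "\<exists>C. C \<subseteq> range f \<and> pairwise orthogonal C \<and> (\<forall>x\<in>C. norm x = 1) \<and>
      independent C \<and> span C = range f"
    by (rule orthonormal_basis_subspace) (intro exI conjI ballI; assumption | simp)
  then obtain C where C: "C \<subseteq> range f" "pairwise orthogonal C" "\<forall>x\<in>C. norm x = 1"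
      "independent C" "span C = range f"
    by (elim exE conjE)
  define B where "B = f -` C"
  have fB: "f ` B = C" using C(1) by (auto simp: B_def)
  have "finite C" using C(4) by (simp add: independent_imp_finite)
  then have fin: "finite B" using inj by (simp add: B_def finite_vimageI)
  have zero: "(\<forall>u\<in>B. x \<bullet> u = 0) \<longleftrightarrow> x = 0" for x
  proof
    assume "\<forall>u\<in>B. x \<bullet> u = 0"
    then have "\<forall>u\<in>B. f x \<bullet> f u = 0" by (simp only: isom)
    then have "\<forall>c\<in>C. orthogonal (f x) c" by (simp add: fB[symmetric] orthogonal_def)
    then have "orthogonal (f x) y" if "y \<in> span C" for y
      using orthogonal_to_span[OF that] by blast
    then have "f x \<bullet> f x = 0" using C(5) by (simp add: orthogonal_def)
    then show "x = 0" using isom[of x x] by simp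
  qed simp
  have nemp: "B \<noteq> {}"
  proof
    assume "B = {}"
    then show False using zero[of z] nz by simp
  qed
  have orth: "u \<bullet> v = (if u = v then 1 else 0)" if "u \<in> B" "v \<in> B" for u v
  proof (cases "u = v")
    case True
    have "norm (f v) = 1" using that C(3) by (simp add: B_def)
    then have "v \<bullet> v = 1" unfolding isom norm_eq_1 .
    then show ?thesis using True by simp
  next
    case False
    then have "f u \<noteq> f v" using inj by (simp add: inj_eq)
    moreover have "f u \<in> C" "f v \<in> C" using that by (simp_all add: B_def)
    ultimately have "orthogonal (f u) (f v)" using C(2) unfolding pairwise_def by blast
    then show ?thesis using False unfolding isom orthogonal_def by simp
  qed
  show ?thesis
    by (intro exI[of _ B] conjI ballI allI nemp fin orth zero)
qed

lift_definition wedge :: "real ^ 5 \<Rightarrow> real ^ 5 \<Rightarrow> wedge2" (infixl \<open>\<and>\<^sub>V\<close> 75)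
  is "\<lambda>v w. \<chi> i j. v $ i * w $ j - v $ j * w $ i"
  by (simp add: transpose_def vec_eq_iff)

lemma bilinear_wedge: "bilinear (\<and>\<^sub>V)"
  unfolding bilinear_def
  by (auto intro!: linearI wedge2_eqI
      simp: wedge.rep_eq plus_wedge2.rep_eq scaleR_wedge2.rep_eq vec_eq_iff algebra_simps)

lemma wedge_self: "v \<and>\<^sub>V v = 0"
  by transfer (simp add: vec_eq_iff mult.commute)

lemma wedge_swap: "w \<and>\<^sub>V v = - (v \<and>\<^sub>V w)"
  by transfer (simp add: vec_eq_iff algebra_simps)

lemma sum_delta2:
  fixes h :: "'n::finite \<Rightarrow> 'm::finite \<Rightarrow> real"
  shows "(\<Sum>i\<in>UNIV. \<Sum>j\<in>UNIV. h i j * ((if k = i then 1 else 0) * (if l = j then 1 else 0))) = h k l"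
proof -
  have "(\<Sum>j\<in>UNIV. h i j * ((if k = i then 1 else 0) * (if l = j then 1 else 0))) =
      (if k = i then h i l else 0)" for i
  proof -
    have "h i j * ((if k = i then 1 else 0) * (if l = j then 1 else 0)) =
        (if l = j then (if k = i then h i j else 0) else 0)" for j by simp
    then show ?thesis by simp
  qed
  then show ?thesis by simp
qed

lemma wedge2_expand:
  "a = (\<Sum>i\<in>UNIV. \<Sum>j\<in>UNIV. (mat_of a $ i $ j / 2) *\<^sub>R (\<sigma> i \<and>\<^sub>V \<sigma> j))"
proof (rule wedge2_eqI)
  let ?m = "mat_of a"
  let ?d = "\<lambda>i j :: 5. if i = j then 1 else 0 :: real"
  have anti: "?m $ j $ i = - ?m $ i $ j" for i j
  proof -
    have "transpose ?m $ i $ j = (- ?m) $ i $ j"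
      using mat_of[of a] by simp
    then show ?thesis by (simp add: transpose_def)
  qed
  have w: "mat_of (\<sigma> i \<and>\<^sub>V \<sigma> j) $ k $ l = ?d k i * ?d l j - ?d l i * ?d k j" for i j k l
    by (simp only: wedge.rep_eq axis_def vec_lambda_beta)
  have "mat_of (\<Sum>i\<in>UNIV. \<Sum>j\<in>UNIV. (?m $ i $ j / 2) *\<^sub>R (\<sigma> i \<and>\<^sub>V \<sigma> j)) $ k $ l
      = ?m $ k $ l" for k l
  proof -
    have "mat_of (\<Sum>i\<in>UNIV. \<Sum>j\<in>UNIV. (?m $ i $ j / 2) *\<^sub>R (\<sigma> i \<and>\<^sub>V \<sigma> j)) $ k $ l
      = (\<Sum>i\<in>UNIV. \<Sum>j\<in>UNIV. (?m $ i $ j / 2) * mat_of (\<sigma> i \<and>\<^sub>V \<sigma> j) $ k $ l)"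
      by (simp only: linear_sum[OF linear_mat_of] linear_cmul[OF linear_mat_of] sum_component
          vector_scaleR_component real_scaleR_def)
    also have "\<dots> = (\<Sum>i\<in>UNIV. \<Sum>j\<in>UNIV. (?m $ i $ j / 2) * (?d k i * ?d l j))
        - (\<Sum>i\<in>UNIV. \<Sum>j\<in>UNIV. (?m $ i $ j / 2) * (?d l i * ?d k j))"
      by (simp only: w right_diff_distrib sum_subtractf)
    also have "\<dots> = ?m $ k $ l / 2 - ?m $ l $ k / 2"
      by (simp only: sum_delta2)
    also have "\<dots> = ?m $ k $ l" using anti[of l k] by linarith
    finally show ?thesis .
  qed
  then show "?m = mat_of (\<Sum>i\<in>UNIV. \<Sum>j\<in>UNIV. (?m $ i $ j / 2) *\<^sub>R (\<sigma> i \<and>\<^sub>V \<sigma> j))"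
    by (simp only: vec_eq_iff simp_thms)
qed

lemma wedge2_universal:
  fixes B :: "real ^ 5 \<Rightarrow> real ^ 5 \<Rightarrow> 'b::real_vector"
  assumes bil: "bilinear B" and alt: "\<And>v. B v v = 0"
  shows "\<exists>!L. linear L \<and> (\<forall>v w. L (v \<and>\<^sub>V w) = B v w)"
proof
  define L where "L a = (\<Sum>i\<in>UNIV. \<Sum>j\<in>UNIV. (mat_of a $ i $ j / 2) *\<^sub>R B (\<sigma> i) (\<sigma> j))" for a
  have swap: "B w v = - B v w" for v w
  proof -
    have "B (v + w) (v + w) = (B v v + B w v) + (B v w + B w w)"
      by (simp only: bilinear_ladd[OF bil] bilinear_radd[OF bil])
    then have "B w v + B v w = 0" by (simp add: alt)
    then show ?thesis by (simp only: eq_neg_iff_add_eq_0)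
  qed
  have expand: "B v w = (\<Sum>i\<in>UNIV. \<Sum>j\<in>UNIV. (v $ i * w $ j) *\<^sub>R B (\<sigma> i) (\<sigma> j))" for v w
  proof -
    have "B v w = B (\<Sum>i\<in>UNIV. v $ i *\<^sub>R \<sigma> i) (\<Sum>j\<in>UNIV. w $ j *\<^sub>R \<sigma> j)"
      using basis_expansion[of v] basis_expansion[of w] by (simp add: scalar_mult_eq_scaleR)
    also have "\<dots> = (\<Sum>(i, j)\<in>UNIV \<times> UNIV. B (v $ i *\<^sub>R \<sigma> i) (w $ j *\<^sub>R \<sigma> j))"
      by (rule bilinear_sum[OF bil])
    also have "\<dots> = (\<Sum>i\<in>UNIV. \<Sum>j\<in>UNIV. (v $ i * w $ j) *\<^sub>R B (\<sigma> i) (\<sigma> j))"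
      by (simp add: bilinear_lmul[OF bil] bilinear_rmul[OF bil] sum.cartesian_product mult.commute)
    finally show ?thesis .
  qed
  have "linear L"
    unfolding L_def
    by (rule linearI) (simp_all add: plus_wedge2.rep_eq scaleR_wedge2.rep_eq add_divide_distrib
        scaleR_left_distrib sum.distrib scaleR_right.sum)
  moreover have "L (v \<and>\<^sub>V w) = B v w" for v w
  proof -
    have "L (v \<and>\<^sub>V w) = (1/2) *\<^sub>R B v w
        - (1/2) *\<^sub>R (\<Sum>i\<in>UNIV. \<Sum>j\<in>UNIV. (w $ i * v $ j) *\<^sub>R B (\<sigma> i) (\<sigma> j))"
      unfolding L_def expand[of v w]
      by (simp add: wedge.rep_eq diff_divide_distrib scaleR_left_diff_distrib sum_subtractf
          scaleR_right.sum mult.commute)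
    also have "\<dots> = (1/2) *\<^sub>R B v w - (1/2) *\<^sub>R B w v"
      by (simp only: expand[of w v])
    also have "\<dots> = B v w"
      using swap[of w v] by (simp flip: scaleR_left_distrib)
    finally show ?thesis .
  qed
  ultimately show "linear L \<and> (\<forall>v w. L (v \<and>\<^sub>V w) = B v w)" by blast
  fix M assume M: "linear M \<and> (\<forall>v w. M (v \<and>\<^sub>V w) = B v w)"
  then have lM: "linear M" by blast
  show "M = L"
  proof
    fix a
    have "M a = M (\<Sum>i\<in>UNIV. \<Sum>j\<in>UNIV. (mat_of a $ i $ j / 2) *\<^sub>R (\<sigma> i \<and>\<^sub>V \<sigma> j))"
      using wedge2_expand[of a] by simp
    also have "\<dots> = L a"
      unfolding L_def using M by (simp add: linear_sum[OF lM] linear_cmul[OF lM])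
    finally show "M a = L a" .
  qed
qed

lemma wedge_12_nonzero: "\<sigma> 1 \<and>\<^sub>V \<sigma> 2 \<noteq> 0"
proof
  assume "\<sigma> 1 \<and>\<^sub>V \<sigma> 2 = 0"
  then have "mat_of (\<sigma> 1 \<and>\<^sub>V \<sigma> 2) $ 1 $ 2 = 0" by (simp add: zero_wedge2.rep_eq)
  then show False by (simp add: wedge.rep_eq axis_def)
qed

instantiation wedge2 :: euclidean_space
begin
definition Basis_wedge2 :: "wedge2 set" where
  "Basis_wedge2 = (SOME B. B \<noteq> {} \<and> finite B \<and>
     (\<forall>u\<in>B. \<forall>v\<in>B. u \<bullet> v = (if u = v then 1 else 0)) \<and> (\<forall>x. (\<forall>u\<in>B. x \<bullet> u = 0) \<longleftrightarrow> x = 0))"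
instance
proof -
  have "(Basis :: wedge2 set) \<noteq> {} \<and> finite (Basis :: wedge2 set) \<and>
     (\<forall>u\<in>Basis. \<forall>v\<in>Basis. u \<bullet> (v::wedge2) = (if u = v then 1 else 0)) \<and>
     (\<forall>x::wedge2. (\<forall>u\<in>Basis. x \<bullet> u = 0) \<longleftrightarrow> x = 0)"
    unfolding Basis_wedge2_def
    by (rule someI_ex) (rule ex_euclidean_basis[OF linear_mat_of inner_wedge2_def wedge_12_nonzero])
  then show "OFCLASS(wedge2, euclidean_space_class)"
    by intro_classes blast+
qed
end


section \<open>The quotient \<open>V' = (\<and>\<^sup>2V) / W\<close>\<close>

definition W :: "wedge2 set" where
  "W = span {\<sigma> 1 \<and>\<^sub>V \<sigma> 4 - \<sigma> 2 \<and>\<^sub>V \<sigma> 3,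
             \<sigma> 1 \<and>\<^sub>V \<sigma> 5 - \<sigma> 2 \<and>\<^sub>V \<sigma> 4,
             \<sigma> 2 \<and>\<^sub>V \<sigma> 5 - \<sigma> 3 \<and>\<^sub>V \<sigma> 4}"

lemma subspace_W: "subspace W"
  by (simp add: W_def)

quotient_type Vprime = wedge2 / "\<lambda>a b. a - b \<in> W" morphisms rep_Vprime modW
proof (rule equivpI)
  show "reflp (\<lambda>a b. a - b \<in> W)" by (simp add: reflp_def subspace_0 subspace_W)
  show "symp (\<lambda>a b. a - b \<in> W)"
    unfolding symp_def using subspace_neg[OF subspace_W] by (metis minus_diff_eq)
  show "transp (\<lambda>a b. a - b \<in> W)"
    unfolding transp_def using subspace_add[OF subspace_W] by (metis diff_add_cancel add_diff_eq)
qed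

lemma modW_eq_iff: "modW a = modW b \<longleftrightarrow> a - b \<in> W"
  using Vprime.abs_eq_iff by blast

lemma modW_cases: obtains a where "x = modW a"
  by (metis Quotient3_Vprime Quotient3_abs_rep)

lemma ex1_orth_rep: "\<exists>!b. a - b \<in> W \<and> b \<in> W\<^sup>\<bottom>"
proof -
  have sW: "span W = W" using subspace_W by (simp add: span_eq_iff)
  obtain y z where yz: "y \<in> W" "\<And>w. w \<in> W \<Longrightarrow> orthogonal z w" "a = y + z"
    using orthogonal_subspace_decomp_exists[of W a] sW by metis
  show ?thesis
  proof
    show "a - z \<in> W \<and> z \<in> W\<^sup>\<bottom>"
      using yz by (auto simp: orthogonal_comp_def orthogonal_commute)
    fix b assume b: "a - b \<in> W \<and> b \<in> W\<^sup>\<bottom>"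
    then have 1: "b - z \<in> W"
      using yz subspace_diff[OF subspace_W, of y "a - b"] by (simp add: algebra_simps)
    have 2: "b - z \<in> W\<^sup>\<bottom>"
      using b yz subspace_diff[OF subspace_orthogonal_comp]
      by (auto simp: orthogonal_comp_def orthogonal_commute orthogonal_clauses)
    from 1 2 show "b = z"
      by (auto simp: orthogonal_comp_def orthogonal_def)
  qed
qed

lift_definition orth_rep :: "Vprime \<Rightarrow> wedge2" is "\<lambda>a. THE b. a - b \<in> W \<and> b \<in> W\<^sup>\<bottom>"
proof -
  fix a a' assume aa: "a - a' \<in> W"
  have "a - b \<in> W \<longleftrightarrow> a' - b \<in> W" for b
    using subspace_diff[OF subspace_W, of "a - b" "a - a'"]
      subspace_add[OF subspace_W, of "a' - b" "a - a'"] aa by auto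
  then show "(THE b. a - b \<in> W \<and> b \<in> W\<^sup>\<bottom>) = (THE b. a' - b \<in> W \<and> b \<in> W\<^sup>\<bottom>)" by simp
qed

lemma orth_rep_modW: "a - orth_rep (modW a) \<in> W \<and> orth_rep (modW a) \<in> W\<^sup>\<bottom>"
  unfolding orth_rep.abs_eq by (rule theI'[OF ex1_orth_rep])

lemma orth_rep_eqI: "a - b \<in> W \<Longrightarrow> b \<in> W\<^sup>\<bottom> \<Longrightarrow> orth_rep (modW a) = b"
  using ex1_orth_rep[of a] orth_rep_modW[of a] by blast

lemma modW_orth_rep: "modW (orth_rep x) = x"
proof -
  obtain a where "x = modW a" by (rule modW_cases)
  then show ?thesis using orth_rep_modW[of a] modW_eq_iff[of a "orth_rep x"] by simp
qed

text \<open>The norm of a class is the norm of its representative orthogonal to \<open>W\<close>, i.e. the quotient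
  norm; so the topology is the vector space topology of \<open>V'\<close>, and \<^term>\<open>lebesgue\<close> on \<open>V'\<close> is
  Lebesgue measure up to a constant factor.\<close>

instantiation Vprime :: real_inner
begin
lift_definition zero_Vprime :: Vprime is 0 .
lift_definition plus_Vprime :: "Vprime \<Rightarrow> Vprime \<Rightarrow> Vprime" is "(+)"
  by (metis add_diff_add subspace_W subspace_add)
lift_definition minus_Vprime :: "Vprime \<Rightarrow> Vprime \<Rightarrow> Vprime" is "(-)"
proof -
  fix a b c d assume "a - b \<in> W" "c - d \<in> W"
  then have "(a - b) - (c - d) \<in> W" by (rule subspace_diff[OF subspace_W])
  then show "(a - c) - (b - d) \<in> W" by (simp add: algebra_simps)
qed
lift_definition uminus_Vprime :: "Vprime \<Rightarrow> Vprime" is "uminus"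
  by (metis minus_diff_minus subspace_W subspace_neg)
lift_definition scaleR_Vprime :: "real \<Rightarrow> Vprime \<Rightarrow> Vprime" is "scaleR"
  by (metis scaleR_right_diff_distrib subspace_W subspace_scale)
definition inner_Vprime :: "Vprime \<Rightarrow> Vprime \<Rightarrow> real"
  where "inner_Vprime x y = orth_rep x \<bullet> orth_rep y"
definition norm_Vprime :: "Vprime \<Rightarrow> real" where "norm_Vprime x = sqrt (inner x x)"
definition sgn_Vprime :: "Vprime \<Rightarrow> Vprime" where "sgn_Vprime x = inverse (norm x) *\<^sub>R x"
definition dist_Vprime :: "Vprime \<Rightarrow> Vprime \<Rightarrow> real" where "dist_Vprime x y = norm (x - y)"
definition uniformity_Vprime :: "(Vprime \<times> Vprime) filter"
  where "uniformity_Vprime = (INF e\<in>{0<..}. principal {(x, y). dist x y < e})"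
definition open_Vprime :: "Vprime set \<Rightarrow> bool"
  where "open_Vprime U \<longleftrightarrow> (\<forall>x\<in>U. eventually (\<lambda>(x', y). x' = x \<longrightarrow> y \<in> U) uniformity)"

lemma orth_rep_add: "orth_rep (x + y) = orth_rep x + orth_rep y"
proof -
  obtain a b where ab: "x = modW a" "y = modW b" using modW_cases by metis
  have "orth_rep (modW (a + b)) = orth_rep x + orth_rep y"
  proof (rule orth_rep_eqI)
    show "a + b - (orth_rep x + orth_rep y) \<in> W"
      using orth_rep_modW[of a] orth_rep_modW[of b] subspace_add[OF subspace_W] ab
      by (metis add_diff_add)
    show "orth_rep x + orth_rep y \<in> W\<^sup>\<bottom>"
      using orth_rep_modW[of a] orth_rep_modW[of b] subspace_add[OF subspace_orthogonal_comp] ab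
      by metis
  qed
  then show ?thesis by (simp add: ab plus_Vprime.abs_eq)
qed

lemma orth_rep_scaleR: "orth_rep (r *\<^sub>R x) = r *\<^sub>R orth_rep x"
proof -
  obtain a where a: "x = modW a" using modW_cases by metis
  have "orth_rep (modW (r *\<^sub>R a)) = r *\<^sub>R orth_rep x"
  proof (rule orth_rep_eqI)
    show "r *\<^sub>R a - r *\<^sub>R orth_rep x \<in> W"
      using orth_rep_modW[of a] subspace_scale[OF subspace_W] a
      by (metis scaleR_right_diff_distrib)
    show "r *\<^sub>R orth_rep x \<in> W\<^sup>\<bottom>"
      using orth_rep_modW[of a] subspace_scale[OF subspace_orthogonal_comp] a by metis
  qed
  then show ?thesis by (simp add: a scaleR_Vprime.abs_eq)
qed

lemma orth_rep_zero: "orth_rep 0 = 0"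
  unfolding zero_Vprime_def
  by (rule orth_rep_eqI) (auto simp: subspace_0 subspace_W subspace_orthogonal_comp)

instance
proof
  fix x y z :: Vprime and r s :: real
  show "x + y + z = x + (y + z)" "x + y = y + x" "0 + x = x" "- x + x = 0" "x - y = x + - y"
    by (transfer; simp add: algebra_simps subspace_0 subspace_W)+
  show "r *\<^sub>R (x + y) = r *\<^sub>R x + r *\<^sub>R y" "(r + s) *\<^sub>R x = r *\<^sub>R x + s *\<^sub>R x"
       "r *\<^sub>R s *\<^sub>R x = (r * s) *\<^sub>R x" "1 *\<^sub>R x = x"
    by (transfer; simp add: algebra_simps subspace_0 subspace_W)+
  show "inner x y = inner y x"
    unfolding inner_Vprime_def by (rule inner_commute)
  show "inner (x + y) z = inner x z + inner y z"
    unfolding inner_Vprime_def orth_rep_add by (rule inner_add_left)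
  show "inner (r *\<^sub>R x) y = r * inner x y"
    unfolding inner_Vprime_def orth_rep_scaleR by (rule inner_scaleR_left)
  show "0 \<le> inner x x"
    unfolding inner_Vprime_def by (rule inner_ge_zero)
  show "inner x x = 0 \<longleftrightarrow> x = 0"
    unfolding inner_Vprime_def
    by (metis inner_eq_zero_iff modW_orth_rep orth_rep_zero)
qed (rule norm_Vprime_def sgn_Vprime_def dist_Vprime_def uniformity_Vprime_def open_Vprime_def)+
end

lemma linear_orth_rep: "linear orth_rep"
  by (rule linearI) (simp_all add: orth_rep_add orth_rep_scaleR)

lemma linear_modW: "linear modW"
  by (rule linearI) (simp_all add: plus_Vprime.abs_eq scaleR_Vprime.abs_eq)

lemma modW_eq_0_iff: "modW a = 0 \<longleftrightarrow> a \<in> W"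
  using modW_eq_iff[of a 0] by (simp add: zero_Vprime_def)

lemma modW_12_nonzero: "modW (\<sigma> 1 \<and>\<^sub>V \<sigma> 2) \<noteq> 0"
proof
  assume "modW (\<sigma> 1 \<and>\<^sub>V \<sigma> 2) = 0"
  moreover have "W \<subseteq> {a. mat_of a $ 1 $ 2 = 0}"
    unfolding W_def
    by (rule span_minimal)
       (auto simp: subspace_def minus_wedge2.rep_eq wedge.rep_eq axis_def
          plus_wedge2.rep_eq scaleR_wedge2.rep_eq zero_wedge2.rep_eq)
  ultimately have "mat_of (\<sigma> 1 \<and>\<^sub>V \<sigma> 2) $ 1 $ 2 = 0"
    by (auto simp: modW_eq_0_iff)
  then show False by (simp add: wedge.rep_eq axis_def)
qed

instantiation Vprime :: euclidean_space
begin
definition Basis_Vprime :: "Vprime set" where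
  "Basis_Vprime = (SOME B. B \<noteq> {} \<and> finite B \<and>
     (\<forall>u\<in>B. \<forall>v\<in>B. u \<bullet> v = (if u = v then 1 else 0)) \<and> (\<forall>x. (\<forall>u\<in>B. x \<bullet> u = 0) \<longleftrightarrow> x = 0))"
instance
proof -
  have "(Basis :: Vprime set) \<noteq> {} \<and> finite (Basis :: Vprime set) \<and>
     (\<forall>u\<in>Basis. \<forall>v\<in>Basis. u \<bullet> (v::Vprime) = (if u = v then 1 else 0)) \<and>
     (\<forall>x::Vprime. (\<forall>u\<in>Basis. x \<bullet> u = 0) \<longleftrightarrow> x = 0)"
    unfolding Basis_Vprime_def
    by (rule someI_ex) (rule ex_euclidean_basis[OF linear_orth_rep inner_Vprime_def modW_12_nonzero])
  then show "OFCLASS(Vprime, euclidean_space_class)"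
    by intro_classes blast+
qed
end


section \<open>The Lie algebra and the group \<open>G\<close>\<close>

type_synonym lie_alg = "(real ^ 5) \<times> Vprime"

definition lie_bracket :: "lie_alg \<Rightarrow> lie_alg \<Rightarrow> lie_alg" where
  "lie_bracket a b = (0, modW (fst a \<and>\<^sub>V fst b))"

lemma bilinear_lie_bracket: "bilinear lie_bracket"
  unfolding bilinear_def lie_bracket_def
  by (auto intro!: linearI simp: bilinear_ladd[OF bilinear_wedge] bilinear_radd[OF bilinear_wedge]
      bilinear_lmul[OF bilinear_wedge] bilinear_rmul[OF bilinear_wedge]
      linear_add[OF linear_modW] linear_cmul[OF linear_modW])

lemma lie_bracket_self: "lie_bracket a a = 0"
  by (simp add: lie_bracket_def wedge_self linear_0[OF linear_modW] zero_prod_def)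

lemma lie_bracket_2step: "lie_bracket (lie_bracket a b) c = 0"
  by (simp add: lie_bracket_def bilinear_lzero[OF bilinear_wedge] linear_0[OF linear_modW] zero_prod_def)

text \<open>For a nilpotent Lie algebra the exponential map of the simply connected group is a
  diffeomorphism; the group is the Lie algebra itself with the Baker--Campbell--Hausdorff product,
  which in the 2-step case is \<open>a + b + [a, b] / 2\<close>. In these coordinates \<open>exp\<close> is the identity.\<close>

definition G :: "lie_alg monoid" where
  "G = \<lparr>carrier = UNIV, mult = (\<lambda>a b. a + b + (1/2) *\<^sub>R lie_bracket a b), one = 0\<rparr>"

lemma G_simps [simp]:
  "carrier G = UNIV" "a \<otimes>\<^bsub>G\<^esub> b = a + b + (1/2) *\<^sub>R lie_bracket a b" "\<one>\<^bsub>G\<^esub> = 0"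
  by (simp_all add: G_def)

lemma group_G: "group G"
proof (rule groupI)
  fix a b c :: lie_alg
  show "a \<otimes>\<^bsub>G\<^esub> b \<otimes>\<^bsub>G\<^esub> c = a \<otimes>\<^bsub>G\<^esub> (b \<otimes>\<^bsub>G\<^esub> c)"
    by (simp add: bilinear_ladd[OF bilinear_lie_bracket] bilinear_radd[OF bilinear_lie_bracket]
        bilinear_lmul[OF bilinear_lie_bracket] bilinear_rmul[OF bilinear_lie_bracket]
        lie_bracket_2step scaleR_right_distrib)
       (simp add: lie_bracket_def bilinear_rzero[OF bilinear_wedge] linear_0[OF linear_modW]
          zero_prod_def)
  show "\<one>\<^bsub>G\<^esub> \<otimes>\<^bsub>G\<^esub> a = a" by (simp add: bilinear_lzero[OF bilinear_lie_bracket])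
  have "- a \<otimes>\<^bsub>G\<^esub> a = \<one>\<^bsub>G\<^esub>"
    by (simp add: bilinear_lneg[OF bilinear_lie_bracket] lie_bracket_self)
  then show "\<exists>y\<in>carrier G. y \<otimes>\<^bsub>G\<^esub> a = \<one>\<^bsub>G\<^esub>" by (metis G_simps(1) UNIV_I)
qed simp_all

lemma G_one_parameter: "(s *\<^sub>R a) \<otimes>\<^bsub>G\<^esub> (t *\<^sub>R a) = (s + t) *\<^sub>R a"
  by (simp add: bilinear_lmul[OF bilinear_lie_bracket] bilinear_rmul[OF bilinear_lie_bracket]
      lie_bracket_self scaleR_left_distrib)

lemma inv_G: "inv\<^bsub>G\<^esub> a = - a"
  by (rule group.inv_equality[OF group_G])
     (simp_all add: bilinear_lneg[OF bilinear_lie_bracket] lie_bracket_self)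

lemma G_commutator: "a \<otimes>\<^bsub>G\<^esub> b \<otimes>\<^bsub>G\<^esub> inv\<^bsub>G\<^esub> a \<otimes>\<^bsub>G\<^esub> inv\<^bsub>G\<^esub> b = lie_bracket a b"
proof -
  have half: "(1/2) *\<^sub>R z + (1/2) *\<^sub>R z = z" for z :: Vprime
    by (simp flip: scaleR_left_distrib)
  have "modW (fst b \<and>\<^sub>V fst a) = - modW (fst a \<and>\<^sub>V fst b)"
    using wedge_swap[of "fst b" "fst a"] by (simp add: linear_neg[OF linear_modW])
  then show ?thesis
    unfolding inv_G
    by (simp add: lie_bracket_def prod_eq_iff bilinear_ladd[OF bilinear_wedge]
        bilinear_lneg[OF bilinear_wedge] bilinear_rneg[OF bilinear_wedge] wedge_self
        linear_0[OF linear_modW] linear_neg[OF linear_modW] half)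
qed

lemma G_mult_central: "(0, x) \<otimes>\<^bsub>G\<^esub> a = a + (0, x)" "a \<otimes>\<^bsub>G\<^esub> (0, x) = a + (0, x)"
  by (simp_all add: lie_bracket_def bilinear_lzero[OF bilinear_wedge]
      bilinear_rzero[OF bilinear_wedge] linear_0[OF linear_modW] prod_eq_iff)

lemma derived_G: "derived G (carrier G) = {0} \<times> UNIV"
proof
  interpret group G by (rule group_G)
  show "derived G (carrier G) \<subseteq> {0} \<times> UNIV"
  proof
    fix a assume "a \<in> derived G (carrier G)"
    then have "a \<in> generate G (derived_set G (carrier G))" by (simp add: derived_def)
    then show "a \<in> {0} \<times> UNIV"
    proof (induction rule: generate.induct)
      case (incl h)
      then show ?case unfolding G_commutator by (auto simp: lie_bracket_def)
    next
      case (inv h)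
      then show ?case unfolding G_commutator inv_G by (auto simp: lie_bracket_def)
    qed (auto simp: lie_bracket_def zero_prod_def)
  qed
  have sub: "subgroup (derived G (carrier G)) G" by (rule derived_is_subgroup) simp
  have add: "(0, x + y) \<in> derived G (carrier G)"
    if "(0, x) \<in> derived G (carrier G)" "(0, y) \<in> derived G (carrier G)" for x y
    using subgroup.m_closed[OF sub that] unfolding G_mult_central by (simp add: add.commute)
  have gen: "(0, r *\<^sub>R modW (\<sigma> i \<and>\<^sub>V \<sigma> j)) \<in> derived G (carrier G)" for r i j
  proof -
    have "lie_bracket (r *\<^sub>R \<sigma> i, 0) (\<sigma> j, 0) \<in> derived_set G (carrier G)"
      unfolding G_commutator by auto
    then show ?thesis unfolding derived_def
      by (intro generate.incl)
         (simp add: lie_bracket_def bilinear_lmul[OF bilinear_wedge] linear_cmul[OF linear_modW])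
  qed
  have zero: "(0, 0) \<in> derived G (carrier G)"
    using subgroup.one_closed[OF sub] by (simp add: zero_prod_def)
  have sum: "(0, \<Sum>i\<in>I. f i) \<in> derived G (carrier G)"
    if "finite I" "\<And>i. i \<in> I \<Longrightarrow> (0, f i) \<in> derived G (carrier G)" for I :: "5 set" and f
    using that by (induction) (auto simp: zero simp del: G_simps intro: add)
  show "{0} \<times> UNIV \<subseteq> derived G (carrier G)"
  proof clarify
    fix x :: Vprime
    obtain a where a: "x = modW a" by (rule modW_cases)
    have "x = (\<Sum>i\<in>UNIV. \<Sum>j\<in>UNIV. (mat_of a $ i $ j / 2) *\<^sub>R modW (\<sigma> i \<and>\<^sub>V \<sigma> j))"
      using arg_cong[OF wedge2_expand[of a], of modW] unfolding a
      by (simp add: linear_sum[OF linear_modW] linear_cmul[OF linear_modW])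
    then show "(0, x) \<in> derived G (carrier G)" by (auto intro!: sum gen simp del: G_simps)
  qed
qed


section \<open>The quotient \<open>G' = G / \<Theta>\<close>\<close>

definition Theta :: "lie_alg \<Rightarrow> lie_alg set" where
  "Theta \<theta> = generate G {\<theta>}"

definition G' :: "lie_alg \<Rightarrow> lie_alg set monoid" where
  "G' \<theta> = G Mod Theta \<theta>"

text \<open>The quotient topology: a set of cosets is open iff the union of its members is open in \<open>G\<close>;
  see \<open>quotient_map_G'\<close> below.\<close>

definition top_G' :: "lie_alg \<Rightarrow> lie_alg set topology" where
  "top_G' \<theta> = topology (\<lambda>U. U \<subseteq> carrier (G' \<theta>) \<and> open (\<Union>U))"

text \<open>The commutator subgroup \<open>[G', G']\<close>.\<close>

definition D' :: "lie_alg \<Rightarrow> lie_alg set set" where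
  "D' \<theta> = derived (G' \<theta>) (carrier (G' \<theta>))"

definition Aut_G' :: "lie_alg \<Rightarrow> (lie_alg set \<Rightarrow> lie_alg set) monoid" where
  "Aut_G' \<theta> = AutoGroup (G' \<theta>)
     \<lparr>carrier := {\<tau> \<in> auto (G' \<theta>). continuous_map (top_G' \<theta>) (top_G' \<theta>) \<tau>}\<rparr>"

text \<open>The element of \<open>G' / [G', G']\<close> identified with \<open>v \<in> V\<close>.\<close>

definition V_coset :: "lie_alg \<Rightarrow> real ^ 5 \<Rightarrow> lie_alg set set" where
  "V_coset \<theta> v = D' \<theta> #>\<^bsub>G' \<theta>\<^esub> (Theta \<theta> #>\<^bsub>G\<^esub> (v, 0))"

text \<open>The map which \<open>\<tau>\<close> induces on \<open>G' / [G', G']\<close> is, under the identification with \<open>V\<close>,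
  the map \<open>T\<close>.\<close>

definition has_factor ::
    "lie_alg \<Rightarrow> (lie_alg set \<Rightarrow> lie_alg set) \<Rightarrow> (real ^ 5 \<Rightarrow> real ^ 5) \<Rightarrow> bool" where
  "has_factor \<theta> \<tau> T \<longleftrightarrow> (\<forall>v. \<tau> ` V_coset \<theta> v = V_coset \<theta> (T v))"

context
  fixes \<theta> :: lie_alg
  assumes \<theta>: "\<theta> \<in> derived G (carrier G)"
begin

lemma Theta_central: "Theta \<theta> \<subseteq> {0} \<times> UNIV"
proof -
  interpret group G by (rule group_G)
  have "subgroup (derived G (carrier G)) G" by (rule derived_is_subgroup) simp
  then have "generate G {\<theta>} \<subseteq> derived G (carrier G)"
    using \<theta> by (intro generate_subgroup_incl) auto
  then show ?thesis by (simp only: Theta_def derived_G)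
qed

lemma coset_eq: "Theta \<theta> #>\<^bsub>G\<^esub> a = (\<lambda>t. t + a) ` Theta \<theta>"
proof -
  have "t \<otimes>\<^bsub>G\<^esub> a = t + a" if "t \<in> Theta \<theta>" for t
  proof -
    obtain x where "t = (0, x)" using \<open>t \<in> Theta \<theta>\<close> Theta_central by auto
    then show ?thesis by (simp only: G_mult_central add.commute)
  qed
  then show ?thesis unfolding r_coset_def by auto
qed

lemma normal_Theta: "Theta \<theta> \<lhd> G"
proof -
  interpret group G by (rule group_G)
  have "subgroup (Theta \<theta>) G" unfolding Theta_def by (rule generate_is_subgroup) simp
  moreover have "Theta \<theta> #>\<^bsub>G\<^esub> a = a <#\<^bsub>G\<^esub> Theta \<theta>" for a
  proof -
    have "t \<otimes>\<^bsub>G\<^esub> a = a \<otimes>\<^bsub>G\<^esub> t" if "t \<in> Theta \<theta>" for t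
    proof -
      obtain x where "t = (0, x)" using \<open>t \<in> Theta \<theta>\<close> Theta_central by auto
      then show ?thesis by (simp only: G_mult_central)
    qed
    then show ?thesis unfolding r_coset_def l_coset_def by (simp del: G_simps)
  qed
  ultimately show ?thesis by (intro normalI) simp_all
qed

lemma carrier_G': "carrier (G' \<theta>) = range (\<lambda>a. Theta \<theta> #>\<^bsub>G\<^esub> a)"
  by (auto simp: G'_def FactGroup_def RCOSETS_def)

lemma group_G': "group (G' \<theta>)"
  unfolding G'_def by (rule normal.factorgroup_is_group[OF normal_Theta])

lemma coset_hom: "group_hom G (G' \<theta>) (\<lambda>a. Theta \<theta> #>\<^bsub>G\<^esub> a)"
  using normal.r_coset_hom_Mod[OF normal_Theta] group_G group_G'
  by (simp add: group_hom_def group_hom_axioms_def G'_def)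

lemma quotient_map_G': "quotient_map euclidean (top_G' \<theta>) (\<lambda>a. Theta \<theta> #>\<^bsub>G\<^esub> a)"
proof -
  interpret N: normal "Theta \<theta>" G by (rule normal_Theta)
  have self: "a \<in> Theta \<theta> #>\<^bsub>G\<^esub> a" for a
    by (rule N.rcos_self) (simp_all add: N.subgroup_axioms)
  have eq: "Theta \<theta> #>\<^bsub>G\<^esub> a = Theta \<theta> #>\<^bsub>G\<^esub> b" if "a \<in> Theta \<theta> #>\<^bsub>G\<^esub> b" for a b
    using N.repr_independence[OF that _ N.subgroup_axioms] by simp
  have Un: "\<Union>U = {a. Theta \<theta> #>\<^bsub>G\<^esub> a \<in> U}" if "U \<subseteq> carrier (G' \<theta>)" for U
  proof (intro equalityI subsetI)
    fix a assume "a \<in> \<Union>U"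
    then obtain C where C: "C \<in> U" "a \<in> C" by (rule UnionE)
    then obtain b where "C = Theta \<theta> #>\<^bsub>G\<^esub> b"
      using \<open>U \<subseteq> carrier (G' \<theta>)\<close> by (auto simp: carrier_G')
    then show "a \<in> {a. Theta \<theta> #>\<^bsub>G\<^esub> a \<in> U}" using C eq[of a b] by simp
  next
    fix a assume "a \<in> {a. Theta \<theta> #>\<^bsub>G\<^esub> a \<in> U}"
    then have "Theta \<theta> #>\<^bsub>G\<^esub> a \<in> U" by simp
    then show "a \<in> \<Union>U" using self[of a] by (rule UnionI)
  qed
  have top: "istopology (\<lambda>U. U \<subseteq> carrier (G' \<theta>) \<and> open (\<Union>U))"
    unfolding istopology_def
  proof (intro conjI allI impI)
    fix S T
    assume S: "S \<subseteq> carrier (G' \<theta>) \<and> open (\<Union>S)" and T: "T \<subseteq> carrier (G' \<theta>) \<and> open (\<Union>T)"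
    show "S \<inter> T \<subseteq> carrier (G' \<theta>)" using S by (simp add: le_infI1)
    have "\<Union>(S \<inter> T) = {a. Theta \<theta> #>\<^bsub>G\<^esub> a \<in> S \<inter> T}"
      using S by (intro Un) (simp add: le_infI1)
    also have "\<dots> = \<Union>S \<inter> \<Union>T" using Un[of S] Un[of T] S T by (simp add: Collect_conj_eq)
    finally show "open (\<Union>(S \<inter> T))" using S T by (simp add: open_Int)
  next
    fix \<K> assume K: "\<forall>K\<in>\<K>. K \<subseteq> carrier (G' \<theta>) \<and> open (\<Union>K)"
    then show "\<Union>\<K> \<subseteq> carrier (G' \<theta>)" by (simp add: Sup_least)
    from K have "open (\<Union>K\<in>\<K>. \<Union>K)" by (simp add: open_UN)
    moreover have "\<Union>(\<Union>\<K>) = (\<Union>K\<in>\<K>. \<Union>K)" by blast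
    ultimately show "open (\<Union>(\<Union>\<K>))" by simp
  qed
  then have openin: "openin (top_G' \<theta>) U \<longleftrightarrow> U \<subseteq> carrier (G' \<theta>) \<and> open (\<Union>U)" for U
    by (simp add: top_G'_def)
  have "\<Union>(carrier (G' \<theta>)) = UNIV"
    using Un[OF subset_refl] by (simp add: carrier_G')
  then have "openin (top_G' \<theta>) (carrier (G' \<theta>))" by (simp add: openin)
  moreover have "topspace (top_G' \<theta>) \<subseteq> carrier (G' \<theta>)"
    using openin[of "topspace (top_G' \<theta>)"] openin_topspace by simp
  ultimately have topsp: "topspace (top_G' \<theta>) = carrier (G' \<theta>)"
    by (intro equalityI openin_subset)
  show ?thesis
    unfolding quotient_map_def
  proof (intro conjI allI impI)
    show "(\<lambda>a. Theta \<theta> #>\<^bsub>G\<^esub> a) ` topspace euclidean = topspace (top_G' \<theta>)"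
      by (simp add: topsp carrier_G')
    fix U assume "U \<subseteq> topspace (top_G' \<theta>)"
    then have "U \<subseteq> carrier (G' \<theta>)" by (simp only: topsp)
    then show "openin euclidean {a \<in> topspace euclidean. Theta \<theta> #>\<^bsub>G\<^esub> a \<in> U} \<longleftrightarrow>
        openin (top_G' \<theta>) U"
      by (simp add: openin Un)
  qed
qed

lemma D'_eq: "D' \<theta> = range (\<lambda>x. Theta \<theta> #>\<^bsub>G\<^esub> (0, x))"
proof -
  interpret group_hom G "G' \<theta>" "\<lambda>a. Theta \<theta> #>\<^bsub>G\<^esub> a" by (rule coset_hom)
  have "D' \<theta> = (\<lambda>a. Theta \<theta> #>\<^bsub>G\<^esub> a) ` derived G (carrier G)"
    unfolding D'_def carrier_G' using derived_img[of "carrier G"] by simp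
  then show ?thesis unfolding derived_G by auto
qed

lemma coset_mult:
  "(Theta \<theta> #>\<^bsub>G\<^esub> a) \<otimes>\<^bsub>G' \<theta>\<^esub> (Theta \<theta> #>\<^bsub>G\<^esub> b) = Theta \<theta> #>\<^bsub>G\<^esub> (a \<otimes>\<^bsub>G\<^esub> b)"
proof -
  interpret group_hom G "G' \<theta>" "\<lambda>a. Theta \<theta> #>\<^bsub>G\<^esub> a" by (rule coset_hom)
  show ?thesis using hom_mult[of a b] by (simp del: G_simps(2,3))
qed

lemma D'_coset: "D' \<theta> #>\<^bsub>G' \<theta>\<^esub> (Theta \<theta> #>\<^bsub>G\<^esub> (v, y)) = range (\<lambda>x. Theta \<theta> #>\<^bsub>G\<^esub> (v, x))"
proof -
  have "D' \<theta> #>\<^bsub>G' \<theta>\<^esub> (Theta \<theta> #>\<^bsub>G\<^esub> (v, y)) = range (\<lambda>x. Theta \<theta> #>\<^bsub>G\<^esub> (v, y + x))"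
    by (auto simp: r_coset_def[of "G' \<theta>"] D'_eq coset_mult G_mult_central simp del: G_simps)
  also have "\<dots> = (\<lambda>x. Theta \<theta> #>\<^bsub>G\<^esub> (v, x)) ` range ((+) y)" by (simp only: image_image)
  finally show ?thesis by simp
qed

lemma V_coset_eq: "V_coset \<theta> v = range (\<lambda>x. Theta \<theta> #>\<^bsub>G\<^esub> (v, x))"
  unfolding V_coset_def by (rule D'_coset)

lemma V_coset_iso:
  "V_coset \<theta> \<in> iso \<lparr>carrier = UNIV, mult = (+), one = 0\<rparr> (G' \<theta> Mod D' \<theta>)"
proof -
  have carr: "carrier (G' \<theta> Mod D' \<theta>) = range (V_coset \<theta>)"
  proof -
    have "carrier (G' \<theta> Mod D' \<theta>) =
        range (\<lambda>a. D' \<theta> #>\<^bsub>G' \<theta>\<^esub> (Theta \<theta> #>\<^bsub>G\<^esub> a))"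
      by (auto simp: FactGroup_def RCOSETS_def carrier_G')
    also have "\<dots> = range (\<lambda>a :: lie_alg. V_coset \<theta> (fst a))"
      unfolding V_coset_eq by (rule image_cong[OF refl]) (simp add: D'_coset split_paired_all)
    also have "\<dots> = V_coset \<theta> ` range (fst :: lie_alg \<Rightarrow> _)" by (simp only: image_image)
    finally show ?thesis by simp
  qed
  have "inj (V_coset \<theta>)"
  proof (rule injI)
    fix v w assume "V_coset \<theta> v = V_coset \<theta> w"
    then have "Theta \<theta> #>\<^bsub>G\<^esub> (v, 0) \<in> range (\<lambda>x. Theta \<theta> #>\<^bsub>G\<^esub> (w, x))"
      unfolding V_coset_eq by blast
    then obtain x where eq: "Theta \<theta> #>\<^bsub>G\<^esub> (v, 0) = Theta \<theta> #>\<^bsub>G\<^esub> (w, x)" by blast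
    have "0 \<in> Theta \<theta>" using generate.one[of G "{\<theta>}"] by (simp add: Theta_def)
    then have "0 + (v, 0) \<in> (\<lambda>t. t + (w, x)) ` Theta \<theta>" using eq unfolding coset_eq by blast
    then show "v = w" using Theta_central by auto
  qed
  moreover have "V_coset \<theta> v <#>\<^bsub>G' \<theta>\<^esub> V_coset \<theta> w = V_coset \<theta> (v + w)" for v w
  proof -
    have "D' \<theta> \<lhd> G' \<theta>"
      unfolding D'_def by (rule group.derived_self_is_normal[OF group_G'])
    then interpret N: normal "D' \<theta>" "G' \<theta>" .
    have "V_coset \<theta> v <#>\<^bsub>G' \<theta>\<^esub> V_coset \<theta> w
        = D' \<theta> #>\<^bsub>G' \<theta>\<^esub> ((Theta \<theta> #>\<^bsub>G\<^esub> (v, 0)) \<otimes>\<^bsub>G' \<theta>\<^esub> (Theta \<theta> #>\<^bsub>G\<^esub> (w, 0)))"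
      unfolding V_coset_def by (rule N.rcos_sum) (simp_all add: carrier_G')
    also have "\<dots> = V_coset \<theta> (v + w)"
      by (simp add: coset_mult lie_bracket_def D'_coset V_coset_eq)
    finally show ?thesis .
  qed
  ultimately show ?thesis
    unfolding iso_def hom_def bij_betw_def by (simp add: carr)
qed

text \<open>Automorphisms fix the identity, so its orbit is never a union of cosets of \<open>[G', G']\<close>, for
  any \<open>\<theta>\<close>. A description of orbits as unions of such cosets therefore has to leave out points of
  \<open>[G', G']\<close>.\<close>

lemma orbit_one_not_cosets:
  "\<not> (\<exists>\<C>. \<C> \<subseteq> rcosets\<^bsub>G' \<theta>\<^esub> D' \<theta> \<and> orbit (Aut_G' \<theta>) (\<lambda>\<tau>. \<tau>) \<one>\<^bsub>G' \<theta>\<^esub> = \<Union>\<C>)"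
proof
  interpret group "G' \<theta>" by (rule group_G')
  assume "\<exists>\<C>. \<C> \<subseteq> rcosets\<^bsub>G' \<theta>\<^esub> D' \<theta> \<and> orbit (Aut_G' \<theta>) (\<lambda>\<tau>. \<tau>) \<one>\<^bsub>G' \<theta>\<^esub> = \<Union>\<C>"
  then obtain \<C> where C: "\<C> \<subseteq> rcosets\<^bsub>G' \<theta>\<^esub> D' \<theta>"
      "orbit (Aut_G' \<theta>) (\<lambda>\<tau>. \<tau>) \<one>\<^bsub>G' \<theta>\<^esub> = \<Union>\<C>" by blast
  have "\<tau> \<one>\<^bsub>G' \<theta>\<^esub> = \<one>\<^bsub>G' \<theta>\<^esub>" if "\<tau> \<in> carrier (Aut_G' \<theta>)" for \<tau>
    using that hom_one[OF _ group_G' group_G'] by (auto simp: Aut_G'_def auto_def)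
  then have sub: "orbit (Aut_G' \<theta>) (\<lambda>\<tau>. \<tau>) \<one>\<^bsub>G' \<theta>\<^esub> \<subseteq> {\<one>\<^bsub>G' \<theta>\<^esub>}"
    by (auto simp: orbit_def)
  have topsp: "topspace (top_G' \<theta>) = carrier (G' \<theta>)"
    using quotient_map_G' by (auto simp: quotient_map_def carrier_G')
  have "continuous_map (top_G' \<theta>) (top_G' \<theta>) (\<lambda>x\<in>carrier (G' \<theta>). x)"
    by (rule continuous_map_eq[OF continuous_map_id]) (simp add: topsp)
  then have "(\<lambda>x\<in>carrier (G' \<theta>). x) \<in> carrier (Aut_G' \<theta>)"
    by (simp add: Aut_G'_def id_in_auto)
  then have "orbit (Aut_G' \<theta>) (\<lambda>\<tau>. \<tau>) \<one>\<^bsub>G' \<theta>\<^esub> \<noteq> {}" by (auto simp: orbit_def)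
  then have "\<one>\<^bsub>G' \<theta>\<^esub> \<in> \<Union>\<C>" "\<Union>\<C> \<subseteq> {\<one>\<^bsub>G' \<theta>\<^esub>}"
    using sub unfolding C(2) by auto
  then obtain X where "X \<in> \<C>" and X: "X \<subseteq> {\<one>\<^bsub>G' \<theta>\<^esub>}" by blast
  then have "X \<in> rcosets\<^bsub>G' \<theta>\<^esub> D' \<theta>" using C(1) by blast
  then obtain v y where "X = D' \<theta> #>\<^bsub>G' \<theta>\<^esub> (Theta \<theta> #>\<^bsub>G\<^esub> (v, y))"
    unfolding RCOSETS_def carrier_G' by auto
  then have "range (\<lambda>x. Theta \<theta> #>\<^bsub>G\<^esub> (v, x)) \<subseteq> {\<one>\<^bsub>G' \<theta>\<^esub>}"
    using X by (simp only: D'_coset)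
  then have const: "Theta \<theta> #>\<^bsub>G\<^esub> (v, x) = \<one>\<^bsub>G' \<theta>\<^esub>" for x
    by blast
  have all: "(0, x) \<in> Theta \<theta>" for x
  proof -
    have "0 \<in> Theta \<theta>" using generate.one[of G "{\<theta>}"] by (simp add: Theta_def)
    moreover have "(\<lambda>t. t + (v, x)) ` Theta \<theta> = (\<lambda>t. t + (v, 0)) ` Theta \<theta>"
      by (simp only: const flip: coset_eq)
    ultimately have "0 + (v, x) \<in> (\<lambda>t. t + (v, 0)) ` Theta \<theta>" by blast
    then obtain t where "t \<in> Theta \<theta>" "(v, x) = t + (v, 0)" by auto
    moreover from this(2) have "t = (0, x)" by (cases t) simp
    ultimately show ?thesis by simp
  qed
  have "\<theta> \<in> carrier G" by simp
  then have "countable (Theta \<theta>)"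
    unfolding Theta_def
    by (simp only: group.generate_pow[OF group_G] full_SetCompr_eq simp_thms UNIV_I) simp
  then have "countable (snd ` Theta \<theta>)" by blast
  moreover have "snd ` Theta \<theta> = UNIV" using all by force
  ultimately have "countable (UNIV :: Vprime set)" by simp
  moreover have "uncountable (UNIV :: Vprime set)"
    by (rule uncountable_convex[OF convex_UNIV UNIV_I UNIV_I modW_12_nonzero])
  ultimately show False by blast
qed

end

end

theory Submission
  imports Defs
begin

text \<open>An automorphism of \<open>G'\<close> induces a continuous additive, hence linear, bijection \<open>A\<close> of \<open>V\<close>.
    Comparing
  commutators, \<open>\<and>\<^sup>2A\<close> preserves \<open>W\<close> and maps \<open>\<theta>\<close> to \<open>\<plusminus>\<theta>\<close> modulo \<open>W\<close>. As a representation of \<open>SL\<^sub>2\<close>,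
  \<open>V\<close> is the space of binary quartics, \<open>W\<close> that of quadratic forms (the Lie algebra \<open>sl\<^sub>2\<close>) and
      \<open>V'\<close> that of
  binary sextics. The wedge product \<open>S\<^sup>2W \<rightarrow> \<and>\<^sup>4V\<close> shows that \<open>A\<close> preserves, up to scalars, the
      invariant
  quadratic form on \<open>W\<close> and then the one on \<open>V\<close>; so \<open>A\<close> normalises \<open>sl\<^sub>2\<close> in \<open>gl(V)\<close>, and \<open>\<theta>\<close>,
      viewed
  as an element of the complement of \<open>sl\<^sub>2\<close> in \<open>so(V)\<close>, is an eigenvector of conjugation by \<open>A\<close>.
      So are its
  three quadratic covariants. Where they form a basis of \<open>sl\<^sub>2\<close> and the first is not isotropic --
      the
  complement of the zero set of a nonzero polynomial -- this makes \<open>A\<close> commute with \<open>sl\<^sub>2\<close>, so \<open>A\<close>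
      is a
  scalar, and the scalar is \<open>\<plusminus>1\<close>. Conversely \<open>(u, z) \<mapsto> (\<plusminus>u, z + F u)\<close> with \<open>F\<close> linear descends
  to \<open>G'\<close>, so every orbit outside \<open>[G', G']\<close> consists of two cosets.\<close>

section \<open>Zero sets of polynomials and continuous additive maps\<close>

text \<open>If a bounded part of \<open>Z\<close> had positive measure, then so would the limes superior of its
    dilations about \<open>p\<close>
  by the factors \<open>1 + 1/n\<close>; a point of it would lie on a line through \<open>p\<close> meeting \<open>Z\<close> infinitely
      often.\<close>

lemma negligible_finite_on_lines:
  fixes Z :: "'a::euclidean_space set"
  assumes Z: "closed Z" and fin: "\<And>x. finite {s::real. p + s *\<^sub>R (x - p) \<in> Z}"
  shows "negligible Z"
proof -
  have "negligible (Z \<inter> cball p R)" for R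
  proof (rule ccontr)
    assume nn: "\<not> negligible (Z \<inter> cball p R)"
    define K where "K = Z \<inter> cball p R"
    have "compact K" using Z by (auto simp: K_def intro: closed_Int_compact)
    define m where "m = emeasure lebesgue K"
    have m: "m \<noteq> 0" using nn \<open>compact K\<close>
      by (auto simp: m_def K_def negligible_iff_null_sets null_sets_def lmeasurable_compact
          fmeasurableD)
    define c where "c n = 1 + 1 / real (Suc n)" for n
    have c: "c n \<ge> 1" "c n \<le> 2" "c n > 0" for n by (auto simp: c_def field_simps)
    have injc: "inj c" by (auto simp: inj_on_def c_def)
    define S where "S n = (\<lambda>x. c n *\<^sub>R x + (1 - c n) *\<^sub>R p) ` K" for n
    have compS: "compact (S n)" for n
      unfolding S_def by (rule compact_continuous_image[OF _ \<open>compact K\<close>]) (intro continuous_intros)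
    have mS: "emeasure lebesgue (S n) \<ge> m" for n
    proof -
      have "emeasure lebesgue (S n) = ennreal (\<bar>c n\<bar> ^ DIM('a)) * m"
        unfolding S_def m_def using emeasure_lebesgue_affine[of "c n" "(1 - c n) *\<^sub>R p" K]
        by (simp add: ennreal_power)
      also have "\<dots> \<ge> 1 * m"
        using c(1)[of n] by (intro mult_right_mono) (auto intro: one_le_power)
      finally show ?thesis by simp
    qed
    define T where "T n = (\<Union>i\<in>{n..}. S i)" for n
    have T: "T n \<in> sets lebesgue" for n
      unfolding T_def by (intro sets.countable_UN') (auto intro: lmeasurable_compact[OF compS]
          fmeasurableD)
    \<comment> \<open>A common bound gives every \<open>T n\<close> finite measure, so that
      continuity from above applies to the decreasing sequence \<open>T\<close>.\<close>
    have "S n \<subseteq> cball p (2 * R)" for n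
    proof
      fix y assume "y \<in> S n"
      then obtain x where x: "x \<in> K" "y = c n *\<^sub>R x + (1 - c n) *\<^sub>R p" by (auto simp: S_def)
      have "p - y = c n *\<^sub>R (p - x)" by (simp add: x algebra_simps)
      then have "dist p y = c n * dist p x" using c(3)[of n] by (simp add: dist_norm)
      also have "\<dots> \<le> 2 * R"
        using x c[of n] by (intro mult_mono) (auto simp: K_def)
      finally show "y \<in> cball p (2 * R)" by simp
    qed
    then have "T n \<subseteq> cball p (2 * R)" for n by (auto simp: T_def)
    then have "emeasure lebesgue (T n) \<le> emeasure lebesgue (cball p (2 * R))" for n
      by (intro emeasure_mono) auto
    then have Tfin: "emeasure lebesgue (T n) \<noteq> \<infinity>" for n
      using fmeasurableD2[OF lmeasurable_cball[of p "2 * R"]] by (metis top.extremum_uniqueI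
          infinity_ennreal_def)
    have "decseq T" unfolding T_def decseq_def by (intro allI impI UN_mono) auto
    have "(INF n. emeasure lebesgue (T n)) = emeasure lebesgue (\<Inter>n. T n)"
      by (rule INF_emeasure_decseq) (use T \<open>decseq T\<close> Tfin in auto)
    moreover have "m \<le> (INF n. emeasure lebesgue (T n))"
    proof (rule INF_greatest)
      fix n
      have "emeasure lebesgue (S n) \<le> emeasure lebesgue (T n)"
        by (rule emeasure_mono[OF _ T]) (auto simp: T_def)
      then show "m \<le> emeasure lebesgue (T n)" using mS[of n] by order
    qed
    ultimately have "(\<Inter>n. T n) \<noteq> {}" using m by (auto simp: not_le)
    then obtain y where y: "y \<in> T n" for n by blast
    have "infinite {i. y \<in> S i}"
      unfolding infinite_nat_iff_unbounded_le using y by (auto simp: T_def)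
    moreover have "(\<lambda>i. 1 / c i) ` {i. y \<in> S i} \<subseteq> {s. p + s *\<^sub>R (y - p) \<in> Z}"
    proof clarify
      fix i assume "y \<in> S i"
      then obtain x where x: "x \<in> K" "y = c i *\<^sub>R x + (1 - c i) *\<^sub>R p" by (auto simp: S_def)
      have "y - p = c i *\<^sub>R (x - p)" by (simp add: x algebra_simps)
      then have "p + (1 / c i) *\<^sub>R (y - p) = x" using c(3)[of i] by simp
      then show "p + (1 / c i) *\<^sub>R (y - p) \<in> Z" using x by (simp add: K_def)
    qed
    moreover have "inj (\<lambda>i. 1 / c i)" using injc c by (auto simp: inj_on_def)
    ultimately show False
      using fin[of y] by (meson finite_imageD finite_subset inj_on_subset subset_UNIV)
  qed
  then have "negligible (\<Union>n::nat. Z \<inter> cball p (real n))" by (rule negligible_Union_nat)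
  moreover have "Z \<subseteq> (\<Union>n::nat. Z \<inter> cball p (real n))"
    using real_arch_simple by (auto simp: subset_eq)
  ultimately show ?thesis using negligible_subset by blast
qed

text \<open>On a line through \<open>p\<close> the function becomes a polynomial in one variable
  that is nonzero at parameter 0, hence has finitely many roots.\<close>

lemma negligible_zeros_polynomial:
  fixes f :: "'a::euclidean_space \<Rightarrow> real"
  assumes f: "real_polynomial_function f" and p: "f p \<noteq> 0"
  shows "negligible {x. f x = 0}"
proof (rule negligible_finite_on_lines)
  show "closed {x. f x = 0}"
    using f by (intro closed_Collect_eq continuous_on_polymonial_function)
      (auto simp: real_polynomial_function_eq[symmetric])
  fix x
  have "polynomial_function (\<lambda>s. p + s *\<^sub>R (x - p))"
    by (intro polynomial_function_add polynomial_function_const polynomial_function_bounded_linear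
        bounded_linear_scaleR_left)
  then have "real_polynomial_function (f \<circ> (\<lambda>s. p + s *\<^sub>R (x - p)))"
    using f by (rule real_polynomial_function_compose)
  then obtain a n where an: "f \<circ> (\<lambda>s. p + s *\<^sub>R (x - p)) = (\<lambda>s. \<Sum>i\<le>n. a i * s^i)"
    by (auto simp: real_polynomial_function_iff_sum)
  have "\<exists>k\<le>n. a k \<noteq> 0"
  proof (rule ccontr)
    assume "\<not> ?thesis"
    then have "f p = 0" using fun_cong[OF an, of 0] by simp
    then show False using p by simp
  qed
  moreover have "f (p + s *\<^sub>R (x - p)) = (\<Sum>i\<le>n. a i * s^i)" for s
    using fun_cong[OF an, of s] by simp
  ultimately show "finite {s. p + s *\<^sub>R (x - p) \<in> {x. f x = 0}}"
    by (simp add: polyfun_finite_roots)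
qed

text \<open>Additivity gives homogeneity over the rationals, and continuity extends it to their
  closure.\<close>

lemma linear_of_continuous_additive:
  fixes f :: "'a::real_normed_vector \<Rightarrow> 'b::real_normed_vector"
  assumes add: "\<And>x y. f (x + y) = f x + f y" and cont: "continuous_on UNIV f"
  shows "linear f"
proof (rule linearI[OF add])
  interpret additive f by standard (rule add)
  have nat: "f (real n *\<^sub>R x) = real n *\<^sub>R f x" for n x
    by (induction n) (simp_all add: zero add scaleR_left_distrib)
  have int: "f (real_of_int k *\<^sub>R x) = real_of_int k *\<^sub>R f x" for k x
    by (cases k) (simp_all add: nat minus del: of_nat_Suc)
  have rat: "f (r *\<^sub>R x) = r *\<^sub>R f x" if "r \<in> \<rat>" for r x
  proof -
    obtain k n where r: "r = real_of_int k / real_of_int n" "n \<noteq> 0"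
      using \<open>r \<in> \<rat>\<close> by (auto elim!: Rats_cases')
    have "real_of_int n *\<^sub>R f (r *\<^sub>R x) = f (real_of_int n *\<^sub>R r *\<^sub>R x)" by (rule int[symmetric])
    also have "\<dots> = real_of_int n *\<^sub>R r *\<^sub>R f x" using r by (simp add: int)
    finally show ?thesis using r(2) by (simp del: scaleR_scaleR)
  qed
  fix r x
  have "closed {r. f (r *\<^sub>R x) = r *\<^sub>R f x}"
    by (intro closed_Collect_eq continuous_on_compose2[OF cont] continuous_intros) auto
  then have "closure \<rat> \<subseteq> {r. f (r *\<^sub>R x) = r *\<^sub>R f x}"
    using rat by (intro closure_minimal) auto
  then show "f (r *\<^sub>R x) = r *\<^sub>R f x" by (auto simp: Rats_closure_real)
qed

section \<open>The wedge product on skew matrices\<close>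

lemma exhaust_5: "i = 1 \<or> i = 2 \<or> i = 3 \<or> i = 4 \<or> i = 5" for i :: 5
proof (induct i)
  case (of_int z)
  then have "z = 0 \<or> z = 1 \<or> z = 2 \<or> z = 3 \<or> z = 4" by auto
  then show ?case by auto
qed

lemma forall_5: "(\<forall>i::5. P i) \<longleftrightarrow> P 1 \<and> P 2 \<and> P 3 \<and> P 4 \<and> P 5"
  by (metis exhaust_5)

lemma UNIV_5: "(UNIV :: 5 set) = {1, 2, 3, 4, 5}"
  using exhaust_5 by auto

lemma sum_5: "(\<Sum>i\<in>UNIV. f i) = f 1 + f 2 + f 3 + f 4 + f (5::5)"
  unfolding UNIV_5 by (simp add: add.assoc)

text \<open>The action of \<open>A\<close> on the exterior square of V, in terms of skew matrices;
  see \<open>ext2_wedge\<close>.\<close>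

definition conj_mat :: "real^5^5 \<Rightarrow> real^5^5 \<Rightarrow> real^5^5" where
  "conj_mat A a = A ** a ** transpose A"

text \<open>For skew \<open>a, b\<close> the form \<open>v \<mapsto> pfaff a b v\<close> is \<open>a \<and> b \<in> \<and>\<^sup>4V\<close> under \<open>\<and>\<^sup>4V = V\<^sup>* \<otimes> \<and>\<^sup>5V\<close>.\<close>

definition pfaff :: "real^5^5 \<Rightarrow> real^5^5 \<Rightarrow> real^5 \<Rightarrow> real" where
  "pfaff a b v =
     v$1 * (a$2$3 * b$4$5 - a$2$4 * b$3$5 + a$2$5 * b$3$4 + b$2$3 * a$4$5 - b$2$4 * a$3$5 + b$2$5
         * a$3$4)
   - v$2 * (a$1$3 * b$4$5 - a$1$4 * b$3$5 + a$1$5 * b$3$4 + b$1$3 * a$4$5 - b$1$4 * a$3$5 + b$1$5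
       * a$3$4)
   + v$3 * (a$1$2 * b$4$5 - a$1$4 * b$2$5 + a$1$5 * b$2$4 + b$1$2 * a$4$5 - b$1$4 * a$2$5 + b$1$5
       * a$2$4)
   - v$4 * (a$1$2 * b$3$5 - a$1$3 * b$2$5 + a$1$5 * b$2$3 + b$1$2 * a$3$5 - b$1$3 * a$2$5 + b$1$5
       * a$2$3)
   + v$5 * (a$1$2 * b$3$4 - a$1$3 * b$2$4 + a$1$4 * b$2$3 + b$1$2 * a$3$4 - b$1$3 * a$2$4 + b$1$4
       * a$2$3)"

lemma conj_mat_nth: "conj_mat A a $ i $ j = (\<Sum>k\<in>UNIV. \<Sum>l\<in>UNIV. A$i$k * a$k$l * A$j$l)"
proof -
  have "conj_mat A a $ i $ j = (\<Sum>l\<in>UNIV. \<Sum>k\<in>UNIV. A$i$k * a$k$l * A$j$l)"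
    by (simp add: conj_mat_def matrix_matrix_mult_def transpose_def sum_distrib_right)
  then show ?thesis using sum.swap by simp
qed

lemma conj_mat_mult: "conj_mat (A ** B) a = conj_mat A (conj_mat B a)"
  by (simp add: conj_mat_def matrix_transpose_mul matrix_mul_assoc)

lemma conj_mat_skew:
  assumes "transpose a = - a"
  shows "transpose (conj_mat A a) = - conj_mat A a"
proof -
  have "A ** (- a) ** transpose A = - (A ** a ** transpose A)"
    by (simp add: vec_eq_iff matrix_matrix_mult_def sum_negf)
  then show ?thesis
    using assms by (simp add: conj_mat_def matrix_transpose_mul matrix_mul_assoc)
qed

lemma skew_nth:
  assumes "transpose a = - (a :: real^5^5)"
  shows "a$2$1 = - a$1$2" "a$3$1 = - a$1$3" "a$4$1 = - a$1$4" "a$5$1 = - a$1$5"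
    "a$3$2 = - a$2$3" "a$4$2 = - a$2$4" "a$5$2 = - a$2$5" "a$4$3 = - a$3$4" "a$5$3 = - a$3$5"
    "a$5$4 = - a$4$5" "a$i$i = 0"
proof -
  have *: "a$j$i = - a$i$j" for i j
  proof -
    have "transpose a $ i $ j = - a$i$j" using assms by simp
    then show ?thesis by (simp add: transpose_def)
  qed
  then show "a$2$1 = - a$1$2" "a$3$1 = - a$1$3" "a$4$1 = - a$1$4" "a$5$1 = - a$1$5"
    "a$3$2 = - a$2$3" "a$4$2 = - a$2$4" "a$5$2 = - a$2$5" "a$4$3 = - a$3$4" "a$5$3 = - a$3$5"
    "a$5$4 = - a$4$5" by blast+
  show "a$i$i = 0" using *[of i i] by simp
qed

text \<open>The factor is \<open>d = det A\<close>, but only its existence is needed.\<close>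

lemma pfaff_conj:
  "\<exists>d. \<forall>a b v. transpose a = - a \<longrightarrow> transpose b = - b \<longrightarrow>
     pfaff (conj_mat A a) (conj_mat A b) (A *v v) = d * pfaff a b v"
proof (induction A rule: induct_matrix_elementary)
  case (1 A B)
  then obtain d e where
    "\<And>a b v. transpose a = - a \<Longrightarrow> transpose b = - b \<Longrightarrow>
       pfaff (conj_mat A a) (conj_mat A b) (A *v v) = d * pfaff a b v"
    "\<And>a b v. transpose a = - a \<Longrightarrow> transpose b = - b \<Longrightarrow>
       pfaff (conj_mat B a) (conj_mat B b) (B *v v) = e * pfaff a b v"
    by metis
  then show ?case
    by (intro exI[of _ "d * e"]) (simp add: conj_mat_mult conj_mat_skew flip:
        matrix_vector_mul_assoc)
next
  case (2 A i)
  then have A: "A$i$k = 0" for k by (simp add: row_def vec_eq_iff)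
  then have "conj_mat A a $ i $ j = 0" "conj_mat A a $ j $ i = 0" "(A *v v) $ i = 0" for a j v
    by (simp_all add: conj_mat_nth matrix_vector_mult_def)
  \<comment> \<open>Each monomial of \<open>pfaff\<close> contains each of the five indices exactly
    once, so a zero row of \<open>A\<close> kills them all.\<close>
  then have "pfaff (conj_mat A a) (conj_mat A b) (A *v v) = 0" for a b v
    using exhaust_5[of i] unfolding pfaff_def by (elim disjE) simp_all
  then show ?case by (intro exI[of _ 0]) simp
next
  case (3 A)
  define d where "d i = A$i$i" for i
  have A: "A$i$k = (if k = i then d i else 0)" for i k using 3[of i k] by (auto simp: d_def)
  have [simp]: "conj_mat A a $ i $ j = d i * a$i$j * d j" for a i j
    unfolding conj_mat_nth A by (simp add: mult_delta_left mult_delta_right)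
  have [simp]: "(A *v v) $ i = d i * v$i" for v i
    unfolding matrix_vector_mult_def vec_lambda_beta A by (simp add: mult_delta_left
        mult_delta_right)
  show ?case
    by (intro exI[of _ "d 1 * d 2 * d 3 * d 4 * d 5"] allI impI) (simp add: pfaff_def algebra_simps)
next
  case (4 m n)
  define s where "s = Transposition.transpose m n"
  define A where "A = ((\<chi> i j. mat 1 $ i $ Transposition.transpose m n j) :: real^5^5)"
  have A: "A$i$k = (if k = s i then 1 else 0)" for i k
    by (auto simp: A_def mat_def s_def)
  have [simp]: "conj_mat A a $ i $ j = a$(s i)$(s j)" for a i j
    unfolding conj_mat_nth A by (simp add: mult_delta_left mult_delta_right)
  have [simp]: "(A *v v) $ i = v$(s i)" for v i
    unfolding matrix_vector_mult_def vec_lambda_beta A by (simp add: mult_delta_left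
        mult_delta_right)
  have "pfaff (conj_mat A a) (conj_mat A b) (A *v v) = - pfaff a b v"
    if "transpose a = - a" "transpose b = - b" for a b v
    using 4 exhaust_5[of m] exhaust_5[of n] skew_nth[OF that(1)] skew_nth[OF that(2)]
    by (elim disjE) (simp_all add: pfaff_def s_def Transposition.transpose_def algebra_simps)
  then show ?case unfolding A_def by (intro exI[of _ "-1"]) simp
next
  case (5 m n c)
  define A where "A = ((\<chi> i j. if i = m \<and> j = n then c else of_bool (i = j)) :: real^5^5)"
  have A: "A$i$k = (if k = i then 1 else 0) + (if k = n then (if i = m then c else 0) else 0)" for
      i k
    using 5 by (auto simp: A_def)
  have [simp]: "conj_mat A a $ i $ j = a$i$j + (if i = m then c * a$n$j else 0) + (if j = m then c
      * a$i$n else 0)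
      + (if i = m \<and> j = m then c^2 * a$n$n else 0)" for a i j
    unfolding conj_mat_nth A
    by (simp add: distrib_right distrib_left sum.distrib mult_delta_left mult_delta_right
        power2_eq_square)
  have [simp]: "(A *v v) $ i = v$i + (if i = m then c * v$n else 0)" for v i
    unfolding matrix_vector_mult_def vec_lambda_beta A 
    by (simp add: distrib_right sum.distrib mult_delta_left mult_delta_right)
  have "pfaff (conj_mat A a) (conj_mat A b) (A *v v) = pfaff a b v"
    if "transpose a = - a" "transpose b = - b" for a b v
    using 5 exhaust_5[of m] exhaust_5[of n] skew_nth[OF that(1)] skew_nth[OF that(2)]
    by (elim disjE) (simp_all add: pfaff_def algebra_simps)
  then show ?case unfolding A_def by (intro exI[of _ 1]) simp
qed

section \<open>The stabilizer of \<open>W\<close>\<close>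

definition skew_unit :: "5 \<Rightarrow> 5 \<Rightarrow> real^5^5" where
  "skew_unit i j = (\<chi> k l. of_bool (k = i \<and> l = j) - of_bool (k = j \<and> l = i))"

text \<open>Coordinates with respect to the three spanning vectors of \<open>W\<close>, written as
  skew matrices; \<open>W_iff\<close> is the link to \<open>W\<close>.\<close>

definition wmat :: "real^3 \<Rightarrow> real^5^5" where
  "wmat x = x$1 *\<^sub>R (skew_unit 1 4 - skew_unit 2 3) + x$2 *\<^sub>R (skew_unit 1 5 - skew_unit 2 4) +
      x$3 *\<^sub>R (skew_unit 2 5 - skew_unit 3 4)"

text \<open>\<open>Smat\<close> is the symmetric form on \<open>V\<^sup>*\<close> for which \<open>Smat_kvec\<close> holds, \<open>Jmat\<close> is its inverse,
    and \<open>Qmat\<close> the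
  relation \<open>w\<^sub>2 \<and> w\<^sub>2 = 2 w\<^sub>1 \<and> w\<^sub>3\<close> that spans the kernel of \<open>S\<^sup>2W \<rightarrow> \<and>\<^sup>4V\<close>.\<close>

definition Jmat :: "real^5^5" where
  "Jmat = (\<chi> i j. if i = 1 \<and> j = 5 \<or> i = 5 \<and> j = 1 then 2 else
     if i = 2 \<and> j = 4 \<or> i = 4 \<and> j = 2 then -1 else if i = 3 \<and> j = 3 then 3 else 0)"

definition Smat :: "real^5^5" where
  "Smat = (\<chi> i j. if i = 1 \<and> j = 5 \<or> i = 5 \<and> j = 1 then 1/2 else
     if i = 2 \<and> j = 4 \<or> i = 4 \<and> j = 2 then -1 else if i = 3 \<and> j = 3 then 1/3 else 0)"

definition Qmat :: "real^3^3" where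
  "Qmat = (\<chi> i j. if i = 2 \<and> j = 2 then 1 else if i = 1 \<and> j = 3 \<or> i = 3 \<and> j = 1 then -1 else 0)"

text \<open>The discriminant of binary quadratic forms, polarised and in suitably scaled
  coordinates; its Gram matrix is \<open>Qmat\<close>.\<close>

definition qform :: "real^3 \<Rightarrow> real^3 \<Rightarrow> real" where
  "qform x y = x$2 * y$2 - x$1 * y$3 - x$3 * y$1"

text \<open>The product of two elements of \<open>W\<close> in the fourth exterior power, read as a
  linear form on V; see \<open>pfaff_wmat\<close>.\<close>

definition kvec :: "real^3 \<Rightarrow> real^3 \<Rightarrow> real^5" where
  "kvec x y = (- 2 * x$3 * y$3) *\<^sub>R axis 1 1 + (x$2 * y$3 + x$3 * y$2) *\<^sub>R axis 2 1
     - (x$1 * y$3 + x$3 * y$1 + 2 * x$2 * y$2) *\<^sub>R axis 3 1 + (x$1 * y$2 + x$2 * y$1) *\<^sub>R axis 4 1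
     - (2 * x$1 * y$1) *\<^sub>R axis 5 1"

lemma linear_wmat: "linear wmat"
  by (rule linearI) (simp_all add: wmat_def scaleR_add_left scaleR_add_right)

lemma wmat_nth:
  "wmat x $ 1 = x$1 *\<^sub>R axis 4 1 + x$2 *\<^sub>R axis 5 1"
  "wmat x $ 2 = - x$1 *\<^sub>R axis 3 1 - x$2 *\<^sub>R axis 4 1 + x$3 *\<^sub>R axis 5 1"
  "wmat x $ 3 = x$1 *\<^sub>R axis 2 1 - x$3 *\<^sub>R axis 4 1"
  "wmat x $ 4 = - x$1 *\<^sub>R axis 1 1 + x$2 *\<^sub>R axis 2 1 + x$3 *\<^sub>R axis 3 1"
  "wmat x $ 5 = - x$2 *\<^sub>R axis 1 1 - x$3 *\<^sub>R axis 2 1"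
  by (simp_all add: vec_eq_iff forall_5 wmat_def skew_unit_def axis_def)

lemma wmat_skew: "transpose (wmat x) = - wmat x"
  by (simp add: vec_eq_iff forall_5 transpose_def wmat_nth axis_def)

lemma inj_wmat: "wmat x = wmat y \<Longrightarrow> x = y"
proof -
  assume "wmat x = wmat y"
  then have "wmat x $ 1 $ 4 = wmat y $ 1 $ 4" "wmat x $ 1 $ 5 = wmat y $ 1 $ 5" "wmat x $ 2 $ 5 =
      wmat y $ 2 $ 5"
    by simp_all
  then show "x = y" by (simp add: wmat_nth axis_def vec_eq_iff forall_3)
qed

lemma kvec_nth: "kvec x y $ 1 = - 2 * x$3 * y$3" "kvec x y $ 2 = x$2 * y$3 + x$3 * y$2"
  "kvec x y $ 3 = - (x$1 * y$3 + x$3 * y$1 + 2 * x$2 * y$2)" "kvec x y $ 4 = x$1 * y$2 + x$2 * y$1"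
  "kvec x y $ 5 = - 2 * x$1 * y$1"
  by (simp_all add: kvec_def axis_def)

lemma pfaff_wmat: "pfaff (wmat x) (wmat y) v = kvec x y \<bullet> v"
  by (simp add: pfaff_def wmat_nth axis_def inner_vec_def sum_5 kvec_nth algebra_simps)

text \<open>The right side involves only \<open>qform\<close>, so a similitude of
  \<open>qform\<close> on \<open>W\<close> also scales \<open>Smat\<close> on the products
  \<open>kvec\<close>.\<close>

lemma Smat_kvec:
  "kvec x y \<bullet> (Smat *v kvec u v) =
     qform x u * qform y v + qform x v * qform y u - (2/3) * (qform x y * qform u v)"
  by (simp add: inner_vec_def matrix_vector_mult_def sum_5 Smat_def kvec_nth qform_def field_simps)

lemma Smat_Jmat: "Smat ** Jmat = mat 1"
  by (simp add: vec_eq_iff forall_5 matrix_matrix_mult_def sum_5 Smat_def Jmat_def mat_def)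

lemma Qmat_Qmat: "Qmat ** Qmat = mat 1"
  by (simp add: vec_eq_iff forall_3 matrix_matrix_mult_def sum_3 Qmat_def mat_def)

lemma qform_Qmat: "qform x y = x \<bullet> (Qmat *v y)"
  by (simp add: inner_vec_def matrix_vector_mult_def sum_3 Qmat_def qform_def algebra_simps)

text \<open>The matrices \<open>Xmat x\<close> form the irreducible copy of \<open>sl\<^sub>2\<close> in \<open>gl\<^sub>5\<close>: coordinates 1, 2, 3
    give a raising, a diagonal
  and a lowering operator.\<close>

definition Xmat :: "real^3 \<Rightarrow> real^5^5" where "Xmat x = wmat x ** Jmat"

lemma Xmat_nth:
  "Xmat x $ 1 = (2 * x$2) *\<^sub>R axis 1 1 - x$1 *\<^sub>R axis 2 1"
  "Xmat x $ 2 = (2 * x$3) *\<^sub>R axis 1 1 + x$2 *\<^sub>R axis 2 1 - (3 * x$1) *\<^sub>R axis 3 1"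
  "Xmat x $ 3 = x$3 *\<^sub>R axis 2 1 - x$1 *\<^sub>R axis 4 1"
  "Xmat x $ 4 = (3 * x$3) *\<^sub>R axis 3 1 - x$2 *\<^sub>R axis 4 1 - (2 * x$1) *\<^sub>R axis 5 1"
  "Xmat x $ 5 = x$3 *\<^sub>R axis 4 1 - (2 * x$2) *\<^sub>R axis 5 1"
  by (simp_all add: vec_eq_iff forall_5 Xmat_def matrix_matrix_mult_def sum_5 wmat_nth Jmat_def
      axis_def)

text \<open>This identifies \<open>qform\<close> with a multiple of the trace form, which
  conjugation preserves.\<close>

lemma trace_Xmat: "trace (Xmat x ** Xmat y) = 10 * qform x y"
  by (simp add: trace_def matrix_matrix_mult_def sum_5 Xmat_nth axis_def qform_def)

lemma linear_Xmat: "linear Xmat"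
  by (rule linearI) (simp_all add: vec_eq_iff forall_5 Xmat_nth axis_def algebra_simps)

lemma bilinear_matrix_mult: "bilinear ((**) :: real^'n^'m \<Rightarrow> real^'k^'n \<Rightarrow> real^'k^'m)"
  unfolding bilinear_def
  by (auto intro!: linearI simp: vec_eq_iff matrix_matrix_mult_def sum.distrib sum_distrib_left
      algebra_simps)

lemmas matrix_mult_ladd = bilinear_ladd[OF bilinear_matrix_mult]
  and matrix_mult_radd = bilinear_radd[OF bilinear_matrix_mult]
  and matrix_mult_lsub = bilinear_lsub[OF bilinear_matrix_mult]
  and matrix_mult_rsub = bilinear_rsub[OF bilinear_matrix_mult]
  and matrix_mult_lmul = bilinear_lmul[OF bilinear_matrix_mult]
  and matrix_mult_rmul = bilinear_rmul[OF bilinear_matrix_mult]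
  and matrix_mult_lneg = bilinear_lneg[OF bilinear_matrix_mult]
  and matrix_mult_rneg = bilinear_rneg[OF bilinear_matrix_mult]
  and matrix_mult_lzero = bilinear_lzero[OF bilinear_matrix_mult]
  and matrix_mult_rzero = bilinear_rzero[OF bilinear_matrix_mult]

lemma linear_trace: "linear (trace :: real^'n^'n \<Rightarrow> real)"
  by (rule linearI) (simp_all add: trace_def sum.distrib sum_distrib_left)

text \<open>Coordinates of the projection to \<open>sl\<^sub>2\<close> that is orthogonal for the trace form.\<close>

definition Pvec :: "real^5^5 \<Rightarrow> real^3" where
  "Pvec Y = (- trace (Y ** Xmat (axis 3 1)) / 10) *\<^sub>R axis 1 1 + (trace (Y ** Xmat (axis 2 1)) /
      10) *\<^sub>R axis 2 1
     - (trace (Y ** Xmat (axis 1 1)) / 10) *\<^sub>R axis 3 1"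

lemma qform_nondeg:
  assumes "\<And>x. qform y x = qform z x"
  shows "y = z"
  using assms[of "axis 1 1"] assms[of "axis 2 1"] assms[of "axis 3 1"]
  by (simp add: qform_def axis_def vec_eq_iff forall_3)

lemma vec3_expand: "x = x$1 *\<^sub>R axis 1 1 + x$2 *\<^sub>R axis 2 1 + x$3 *\<^sub>R axis 3 1" for x :: "real^3"
  by (simp add: vec_eq_iff forall_3 axis_def)

lemma trace_Pvec: "trace (Y ** Xmat x) = 10 * qform (Pvec Y) x"
proof -
  have "trace (Y ** Xmat x) = x$1 * trace (Y ** Xmat (axis 1 1)) + x$2 * trace (Y ** Xmat (axis 2
      1))
      + x$3 * trace (Y ** Xmat (axis 3 1))"
    by (subst vec3_expand[of x]) (simp only: linear_add[OF linear_Xmat] linear_cmul[OF linear_Xmat]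
        matrix_mult_radd matrix_mult_rmul linear_add[OF linear_trace] linear_cmul[OF linear_trace]
            real_scaleR_def)
  then show ?thesis by (simp add: Pvec_def qform_def axis_def)
qed

lemma Pvec_eqI: "(\<And>x. trace (Y ** Xmat x) = 10 * qform y x) \<Longrightarrow> Pvec Y = y"
  by (rule qform_nondeg) (simp add: trace_Pvec)

lemma linear_Pvec: "linear Pvec"
  by (rule linearI) (simp_all add: Pvec_def vec_eq_iff forall_3 axis_def
    matrix_mult_ladd matrix_mult_lmul linear_add[OF linear_trace] linear_cmul[OF linear_trace]
        field_simps)

lemma Pvec_Xmat: "Pvec (Xmat x) = x"
  by (rule Pvec_eqI) (rule trace_Xmat)

section \<open>Linear maps that preserve \<open>W\<close>\<close>

locale W_stabilizer =
  fixes A A' :: "real^5^5" and f f' :: "real^3 \<Rightarrow> real^3"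
  assumes inv: "A ** A' = mat 1" "A' ** A = mat 1"
    and f: "conj_mat A (wmat x) = wmat (f x)" and f': "conj_mat A' (wmat x) = wmat (f' x)"
begin

lemma f_f': "f (f' x) = x" "f' (f x) = x"
proof -
  have "conj_mat (mat 1) (wmat y) = wmat y" for y
    by (simp add: conj_mat_def)
  then show "f (f' x) = x" "f' (f x) = x"
    by (auto intro!: inj_wmat simp flip: f f' conj_mat_mult simp: inv)
qed

lemma linear_f: "linear f"
proof (rule linearI)
  show "f (x + y) = f x + f y" for x y
    by (rule inj_wmat) (simp add: linear_add[OF linear_wmat] conj_mat_def matrix_mult_ladd
        matrix_mult_radd
      flip: f)
  show "f (r *\<^sub>R x) = r *\<^sub>R f x" for r x
    by (rule inj_wmat) (simp add: linear_cmul[OF linear_wmat] conj_mat_def matrix_mult_lmul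
        matrix_mult_rmul
      flip: f)
qed

lemma inverse: "W_stabilizer A' A f' f"
  by unfold_locales (simp_all add: inv f f')

lemma linear_f': "linear f'"
  by (rule W_stabilizer.linear_f[OF inverse])

lemma vector_A_A': "v v* A v* A' = v"
  by (simp add: vector_matrix_mul_assoc inv)

text \<open>This is \<open>pfaff_conj\<close> restricted to \<open>W\<close> and dualised. If
  \<open>d\<close> were 0, every \<open>kvec\<close> would vanish, because \<open>f\<close> is onto
  and \<open>A\<close> is invertible.\<close>

lemma kvec_f: "\<exists>d. d \<noteq> 0 \<and> (\<forall>x y. kvec (f x) (f y) v* A = d *\<^sub>R kvec x y)"
proof -
  obtain d where d: "pfaff (conj_mat A a) (conj_mat A b) (A *v v) = d * pfaff a b v"
    if "transpose a = - a" "transpose b = - b" for a b v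
    using pfaff_conj[of A] by blast
  have eq: "kvec (f x) (f y) v* A = d *\<^sub>R kvec x y" for x y
  proof (rule vector_eq_ldot[THEN iffD1], intro allI)
    fix v
    have "kvec (f x) (f y) \<bullet> (A *v v) = d * (kvec x y \<bullet> v)"
      using d[OF wmat_skew wmat_skew, of x y v] by (simp add: f pfaff_wmat)
    then show "v \<bullet> (kvec (f x) (f y) v* A) = v \<bullet> d *\<^sub>R kvec x y"
      by (simp add: dot_lmul_matrix inner_commute[of v])
  qed
  moreover have "d \<noteq> 0"
  proof
    assume "d = 0"
    then have "kvec x y = 0" for x y
      using eq[of "f' x" "f' y"] vector_A_A'[of "kvec x y"] by (simp add: f_f')
    then have "kvec (axis 1 1) (axis 1 1) $ 5 = 0" by simp
    then show False by (simp add: kvec_nth)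
  qed
  ultimately show ?thesis by blast
qed

text \<open>By \<open>kvec_f\<close> the images under \<open>f\<close> of the basis of
  \<open>W\<close> satisfy the same quadratic relation as the basis itself. The relations form the
  line spanned by \<open>Qmat\<close>, so \<open>f\<close> scales \<open>Qmat\<close>, and inverting
  gives the statement about the form.\<close>

lemma qform_f: "\<exists>\<kappa>. \<kappa> \<noteq> 0 \<and> (\<forall>x y. qform (f x) (f y) = \<kappa> * qform x y)"
proof -
  obtain d where d: "d \<noteq> 0" "\<And>x y. kvec (f x) (f y) v* A = d *\<^sub>R kvec x y"
    using kvec_f by blast
  define b where "b i = f (axis i 1)" for i
  have "kvec (axis 2 1) (axis 2 1) = 2 *\<^sub>R kvec (axis 1 1) (axis 3 1)"
    by (simp add: vec_eq_iff forall_5 kvec_nth axis_def)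
  then have "kvec (b 2) (b 2) v* A = (2 *\<^sub>R kvec (b 1) (b 3)) v* A"
    by (simp only: b_def d scaleR_vector_matrix_assoc scaleR_left_commute)
  then have "kvec (b 2) (b 2) = 2 *\<^sub>R kvec (b 1) (b 3)"
    by (metis vector_A_A')
  then have k: "kvec (b 2) (b 2) $ i = 2 * kvec (b 1) (b 3) $ i" for i by simp
  define B where "B = matrix f"
  have B: "f x = B *v x" for x by (simp add: B_def linear_f matrix_works)
  have Bb: "B $ i $ j = b j $ i" for i j by (simp add: B_def b_def matrix_def)
  define \<kappa> where "\<kappa> = b 2 $ 2 * b 2 $ 2 - 2 * b 1 $ 2 * b 3 $ 2"
  \<comment> \<open>Coordinates 1, 2, 4, 5 of the relation are the vanishing entries; coordinate 3
    says that entry (1,3) is minus entry (2,2), which is \<open>\<kappa>\<close>.\<close>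
  have BQB: "B ** Qmat ** transpose B = \<kappa> *\<^sub>R Qmat"
    using k[of 1] k[of 2] k[of 3] k[of 4] k[of 5]
    by (simp add: vec_eq_iff forall_3 matrix_matrix_mult_def transpose_def sum_3 Qmat_def Bb
        kvec_nth \<kappa>_def
       algebra_simps)
  define C where "C = matrix f'"
  have BC: "B ** C = mat 1" "C ** B = mat 1"
    unfolding B_def C_def by (simp_all add: linear_f linear_f' f_f' o_def flip: matrix_compose)
      (simp_all add: matrix_id_mat_1[unfolded id_def])
  \<comment> \<open>\<open>Qmat\<close> is its own inverse, so \<open>BQB\<close> exhibits a
    multiple of a right inverse of \<open>B\<close>; moving \<open>B\<close> to the other side
    transposes the identity.\<close>
  have "B ** (Qmat ** transpose B ** Qmat) = \<kappa> *\<^sub>R mat 1"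
    using BQB by (simp add: matrix_mul_assoc matrix_mult_lmul Qmat_Qmat)
  then have "C ** (B ** (Qmat ** transpose B ** Qmat)) ** B = \<kappa> *\<^sub>R mat 1"
    by (simp add: matrix_mult_lmul matrix_mult_rmul BC)
  then have "Qmat ** transpose B ** Qmat ** B = \<kappa> *\<^sub>R mat 1"
    by (simp add: matrix_mul_assoc BC)
  then have "Qmat ** (Qmat ** transpose B ** Qmat ** B) = \<kappa> *\<^sub>R Qmat"
    by (simp add: matrix_mult_rmul)
  then have BQB': "transpose B ** Qmat ** B = \<kappa> *\<^sub>R Qmat"
    by (simp add: matrix_mul_assoc Qmat_Qmat)
  have q: "qform (f x) (f y) = \<kappa> * qform x y" for x y
  proof -
    have "qform (f x) (f y) = x \<bullet> ((transpose B ** Qmat ** B) *v y)"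
      by (simp only: qform_Qmat B matrix_vector_mul_assoc[symmetric] dot_lmul_matrix[symmetric]
        vector_transpose_matrix)
    then show ?thesis by (simp add: BQB' qform_Qmat scaleR_matrix_vector_assoc[symmetric])
  qed
  moreover have "\<kappa> \<noteq> 0"
  proof
    assume "\<kappa> = 0"
    then have "qform (axis 2 1) (axis 2 1) = 0"
      using q[of "f' (axis 2 1)" "f' (axis 2 1)"] by (simp add: f_f')
    then show False by (simp add: qform_def axis_def)
  qed
  ultimately show ?thesis by blast
qed


text \<open>The map \<open>A\<close> scales \<open>kvec\<close> by \<open>d\<close> and
  \<open>f\<close> scales \<open>qform\<close> by \<open>\<kappa>\<close>. As
  \<open>Smat_kvec\<close> is quadratic in both, the factor is the square of
  \<open>d / \<kappa>\<close>.\<close>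

lemma Smat_conj: "\<exists>c. c \<noteq> 0 \<and> A ** Smat ** transpose A = c *\<^sub>R Smat"
proof -
  obtain d where d: "d \<noteq> 0" "\<And>x y. kvec (f x) (f y) v* A = d *\<^sub>R kvec x y"
    using kvec_f by blast
  obtain \<kappa> where \<kappa>: "\<kappa> \<noteq> 0" "\<And>x y. qform (f x) (f y) = \<kappa> * qform x y"
    using qform_f by blast
  define c where "c = (d / \<kappa>)\<^sup>2"
  have kvec: "(kvec x y v* A) \<bullet> (Smat *v (kvec u v v* A)) = c * (kvec x y \<bullet> (Smat *v kvec u v))"
      for x y u v
  proof -
    define x1 y1 u1 v1 where "x1 = f' x" "y1 = f' y" "u1 = f' u" "v1 = f' v"
    then have *: "x = f x1" "y = f y1" "u = f u1" "v = f v1" by (simp_all add: f_f')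
    show ?thesis
      using \<kappa>(1) unfolding * d(2) \<kappa>(2) Smat_kvec matrix_vector_mult_scaleR inner_scaleR_left
          inner_scaleR_right
      by (simp add: c_def power2_eq_square field_simps)
  qed
  define L where "L p q \<longleftrightarrow> (p v* A) \<bullet> (Smat *v (q v* A)) = c * (p \<bullet> (Smat *v q))" for p q
  have scale: "L (r *\<^sub>R p) (s *\<^sub>R q)" if "L p q" for r s p q
    using that by (simp add: L_def scaleR_vector_matrix_assoc matrix_vector_mult_scaleR)
  \<comment> \<open>Every basis vector is a multiple of a single \<open>kvec\<close>, so the
    identity on such vectors already yields all matrix entries.\<close>
  have "\<exists>x y r. axis i 1 = r *\<^sub>R kvec x y" for i
  proof -
    have "axis 1 1 = (- 1/2) *\<^sub>R kvec (axis 3 1) (axis 3 1)" "axis 2 1 = 1 *\<^sub>R kvec (axis 2 1)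
        (axis 3 1)"
      "axis 3 1 = (- 1/2) *\<^sub>R kvec (axis 2 1) (axis 2 1)" "axis 4 1 = 1 *\<^sub>R kvec (axis 1 1) (axis
          2 1)"
      "axis 5 1 = (- 1/2) *\<^sub>R kvec (axis 1 1) (axis 1 1)"
      by (simp_all add: vec_eq_iff forall_5 kvec_nth axis_def)
    then show ?thesis using exhaust_5[of i] by metis
  qed
  then have "L (axis i 1) (axis j 1)" for i j
    using kvec scale unfolding L_def by metis
  moreover have entry: "axis i 1 \<bullet> (Y *v axis j 1) = Y $ i $ j" for Y :: "real^5^5" and i j
    by (simp add: matrix_vector_mult_basis inner_axis' column_def)
  have "(axis i 1 v* A) \<bullet> (Smat *v (axis j 1 v* A)) = (A ** Smat ** transpose A) $ i $ j" for i j
    by (simp only: entry[symmetric] matrix_vector_mul_assoc[symmetric] dot_lmul_matrix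
        transpose_matrix_vector)
  ultimately have "(A ** Smat ** transpose A) $ i $ j = (c *\<^sub>R Smat) $ i $ j" for i j
    by (simp add: L_def entry)
  then have "A ** Smat ** transpose A = c *\<^sub>R Smat" by (simp only: vec_eq_iff simp_thms)
  moreover have "c \<noteq> 0" using d(1) \<kappa>(1) by (simp add: c_def)
  ultimately show ?thesis by blast
qed

lemma Jmat_conj: "\<exists>c. c \<noteq> 0 \<and> transpose A ** Jmat ** A = c *\<^sub>R Jmat"
proof -
  obtain c where c: "c \<noteq> 0" "A ** Smat ** transpose A = c *\<^sub>R Smat" using Smat_conj by blast
  have "A' ** (A ** Smat ** transpose A) ** Jmat ** A = c *\<^sub>R mat 1"
  proof -
    have "A' ** (A ** Smat ** transpose A) ** Jmat ** A = c *\<^sub>R (A' ** (Smat ** Jmat) ** A)"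
      unfolding c by (simp add: matrix_mult_lmul matrix_mult_rmul matrix_mul_assoc)
    then show ?thesis by (simp add: Smat_Jmat inv)
  qed
  then have "Smat ** (transpose A ** Jmat ** A) = c *\<^sub>R mat 1"
    by (simp add: matrix_mul_assoc inv)
  then have "Jmat ** (Smat ** (transpose A ** Jmat ** A)) = c *\<^sub>R Jmat"
    by (simp add: matrix_mult_rmul)
  moreover have "Jmat ** Smat = mat 1" using Smat_Jmat matrix_left_right_inverse by blast
  ultimately show ?thesis using c(1) by (metis matrix_mul_assoc matrix_mul_lid)
qed

definition scale :: real where
  "scale = (SOME c. c \<noteq> 0 \<and> transpose A ** Jmat ** A = c *\<^sub>R Jmat)"

lemma scale: "scale \<noteq> 0" "transpose A ** Jmat ** A = scale *\<^sub>R Jmat"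
  using someI_ex[OF Jmat_conj] by (simp_all add: scale_def)

text \<open>Right multiplication by \<open>Jmat\<close> identifies the exterior square with so(V)
  for the form \<open>Jmat\<close>; as \<open>A\<close> is a similitude of that form, the action
  becomes conjugation up to \<open>scale\<close>.\<close>

lemma mult_Jmat: "A ** (Y ** Jmat) = (1 / scale) *\<^sub>R (conj_mat A Y ** Jmat ** A)"
proof -
  have "conj_mat A Y ** Jmat ** A = A ** Y ** (transpose A ** Jmat ** A)"
    by (simp add: conj_mat_def matrix_mul_assoc)
  also have "\<dots> = scale *\<^sub>R (A ** (Y ** Jmat))"
    by (simp add: scale matrix_mult_rmul matrix_mul_assoc)
  finally show ?thesis using scale(1) by simp
qed

text \<open>Rescaling \<open>f\<close> by \<open>scale\<close> gives conjugation by \<open>A\<close>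
  on sl2, as \<open>mult_Xmat\<close> shows.\<close>

definition g :: "real^3 \<Rightarrow> real^3" where "g x = (1 / scale) *\<^sub>R f x"

lemma linear_g: "linear g"
  unfolding g_def by (simp add: linear_f linear_compose_scale_right)

lemma surj_g: "\<exists>y. x = g y"
  using scale(1) by (intro exI[of _ "f' (scale *\<^sub>R x)"]) (simp add: g_def f_f')

lemma mult_Xmat: "A ** Xmat x = Xmat (g x) ** A"
  unfolding Xmat_def mult_Jmat f g_def linear_cmul[OF linear_wmat]
  by (simp add: matrix_mult_lmul)

lemma trace_conj:
  assumes "A ** Y = Y' ** A"
  shows "trace Y' = trace Y"
proof -
  have "Y' = A ** Y ** A'" by (simp add: assms inv flip: matrix_mul_assoc)
  then have "trace Y' = trace (A' ** (A ** Y))" by (simp only: trace_mul_sym[of "A ** Y" A'])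
  then show ?thesis by (simp add: matrix_mul_assoc inv)
qed

text \<open>Conjugation preserves traces, so \<open>g\<close> is an isometry, whereas
  \<open>f\<close> is only a similitude.\<close>

lemma qform_g: "qform (g x) (g y) = qform x y"
proof -
  have "A ** (Xmat x ** Xmat y) = Xmat (g x) ** Xmat (g y) ** A"
    by (metis mult_Xmat matrix_mul_assoc)
  from trace_conj[OF this] show ?thesis by (simp add: trace_Xmat)
qed

text \<open>The projection is orthogonal for the trace form, and conjugation by \<open>A\<close>
  preserves both that form and sl2.\<close>

lemma Pvec_conj:
  assumes "A ** Y = Y' ** A"
  shows "Pvec Y' = g (Pvec Y)"
proof (rule Pvec_eqI)
  fix x
  obtain y where x: "x = g y" using surj_g by blast
  have "A ** (Y ** Xmat y) = Y' ** Xmat (g y) ** A"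
    by (metis assms mult_Xmat matrix_mul_assoc)
  from trace_conj[OF this] show "trace (Y' ** Xmat x) = 10 * qform (g (Pvec Y)) x"
    by (simp add: x trace_Pvec qform_g)
qed

end

text \<open>\<open>Mmat a\<close> depends only on \<open>a\<close> modulo \<open>W\<close>. The vectors \<open>cov1, cov2, cov3\<close> are the three
    quadratic covariants
  of degrees 3, 5 and 7 of a binary sextic; their degrees being odd is what excludes \<open>\<mu> = -1\<close>
      below.\<close>

definition Mmat :: "real^5^5 \<Rightarrow> real^5^5" where
  "Mmat a = a ** Jmat - Xmat (Pvec (a ** Jmat))"

definition cov1 :: "real^5^5 \<Rightarrow> real^3" where "cov1 M = Pvec (M ** M ** M)"
definition cov2 :: "real^5^5 \<Rightarrow> real^3" where "cov2 M = Pvec (M ** Xmat (cov1 M) ** M)"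
definition cov3 :: "real^5^5 \<Rightarrow> real^3" where "cov3 M = Pvec (M ** Xmat (cov2 M) ** M)"

text \<open>The first factor is nonzero when \<open>cov1\<close> is not isotropic, the second when
  the covariants form a basis of sl2.\<close>

definition generic :: "real^5^5 \<Rightarrow> real" where
  "generic M = qform (cov1 M) (cov1 M) * det (vector [cov1 M, cov2 M, cov3 M])"

lemma det_nonzero_expand:
  fixes u v w :: "real^3"
  assumes "det (vector [u, v, w] :: real^3^3) \<noteq> 0"
  shows "\<exists>a b c. x = a *\<^sub>R u + b *\<^sub>R v + c *\<^sub>R w"
proof -
  define K where "K = (vector [u, v, w] :: real^3^3)"
  obtain K' where "K' ** K = mat 1" using assms by (auto simp: K_def invertible_det_nz[symmetric]
      invertible_def)
  then have "x = (x v* K') v* K" by (simp add: vector_matrix_mul_assoc)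
  moreover have "y v* K = y$1 *\<^sub>R u + y$2 *\<^sub>R v + y$3 *\<^sub>R w" for y
    by (simp add: vec_eq_iff forall_3 vector_matrix_mult_def sum_3 K_def mult.commute)
  ultimately show ?thesis by metis
qed

section \<open>Action of the stabilizer on the covariants\<close>

context W_stabilizer
begin

text \<open>If conjugation by \<open>A\<close> multiplies \<open>M\<close> by \<open>\<mu>\<close>,
  a covariant of degree k is multiplied by the k-th power; each sandwich between two copies of
  \<open>M\<close> raises the degree by two.\<close>

lemma cov_conj:
  assumes M: "A ** M = \<mu> *\<^sub>R (M ** A)"
  shows "g (cov1 M) = \<mu>^3 *\<^sub>R cov1 M" "g (cov2 M) = \<mu>^5 *\<^sub>R cov2 M" "g (cov3 M) = \<mu>^7 *\<^sub>R cov3 M"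
proof -
  have mid: "A ** (M ** X ** M) = (\<mu>^2 *\<^sub>R (M ** X' ** M)) ** A" if "A ** X = X' ** A" for X X'
  proof -
    have "A ** (M ** X ** M) = \<mu> *\<^sub>R (M ** (A ** X) ** M)"
      by (simp add: matrix_mul_assoc M matrix_mult_lmul)
    also have "\<dots> = \<mu> *\<^sub>R (M ** X' ** (A ** M))"
      by (simp add: that matrix_mul_assoc)
    also have "\<dots> = (\<mu>^2 *\<^sub>R (M ** X' ** M)) ** A"
      by (simp add: M matrix_mult_rmul matrix_mult_lmul matrix_mul_assoc power2_eq_square)
    finally show ?thesis .
  qed
  have "A ** M = (\<mu> *\<^sub>R M) ** A" by (simp add: M matrix_mult_lmul)
  from Pvec_conj[OF mid[OF this]] show 1: "g (cov1 M) = \<mu>^3 *\<^sub>R cov1 M"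
    by (simp add: cov1_def matrix_mult_lmul matrix_mult_rmul linear_cmul[OF linear_Pvec]
        power2_eq_square power3_eq_cube mult.assoc)
  have step: "g (Pvec (M ** Xmat x ** M)) = \<mu>^(k+2) *\<^sub>R Pvec (M ** Xmat x ** M)" if "g x = \<mu>^k *\<^sub>R
      x" for x k
    using Pvec_conj[OF mid[OF mult_Xmat[of x]]]
    by (simp add: that linear_cmul[OF linear_Xmat] matrix_mult_lmul matrix_mult_rmul
        linear_cmul[OF linear_Pvec] power2_eq_square ac_simps)
  from step[OF 1] show 2: "g (cov2 M) = \<mu>^5 *\<^sub>R cov2 M" by (simp add: cov2_def)
  from step[OF 2] show "g (cov3 M) = \<mu>^7 *\<^sub>R cov3 M" by (simp add: cov3_def)
qed

text \<open>Since \<open>g\<close> is an isometry and \<open>cov1\<close> is not isotropic,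
  \<open>\<mu>\<close> is 1 or -1; the odd degrees then make \<open>g\<close> multiplication by
  \<open>\<mu>\<close> on a basis. The value -1 does not respect brackets, so \<open>A\<close>
  centralises sl2, which acts irreducibly.\<close>

lemma scalar_of_generic:
  assumes M: "A ** M = \<mu> *\<^sub>R (M ** A)" and gen: "generic M \<noteq> 0"
  shows "\<exists>s. A = s *\<^sub>R mat 1"
proof -
  note cov = cov_conj[OF M]
  have "\<mu>^6 * qform (cov1 M) (cov1 M) = qform (g (cov1 M)) (g (cov1 M))"
    unfolding cov by (simp add: qform_def algebra_simps eval_nat_numeral)
  also have "\<dots> = qform (cov1 M) (cov1 M)" by (rule qform_g)
  finally have "\<mu>^6 = 1" using gen by (simp add: generic_def)
  then have "\<bar>\<mu>\<bar>^6 = 1^6" by simp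
  then have "\<bar>\<mu>\<bar> = 1" by (rule power_eq_imp_eq_base) simp_all
  then have \<mu>: "\<mu> = 1 \<or> \<mu> = -1" by linarith
  then have pw: "\<mu>^3 = \<mu>" "\<mu>^5 = \<mu>" "\<mu>^7 = \<mu>" by auto
  have g: "g x = \<mu> *\<^sub>R x" for x
  proof -
    obtain a b c where "x = a *\<^sub>R cov1 M + b *\<^sub>R cov2 M + c *\<^sub>R cov3 M"
      using det_nonzero_expand[of "cov1 M" "cov2 M" "cov3 M" x] gen by (auto simp: generic_def)
    then show ?thesis
      by (simp add: linear_add[OF linear_g] linear_cmul[OF linear_g] cov pw algebra_simps)
  qed
  have X: "A ** Xmat x = \<mu> *\<^sub>R (Xmat x ** A)" for x
    by (simp add: mult_Xmat g linear_cmul[OF linear_Xmat] matrix_mult_lmul)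
  let ?X1 = "Xmat (axis 1 1)" and ?X2 = "Xmat (axis 2 1)" and ?X3 = "Xmat (axis 3 1)"
  \<comment> \<open>A product of two elements of sl2 picks up the square of \<open>\<mu>\<close>, so
    \<open>A\<close> commutes with this bracket, hence with \<open>?X2\<close>; for
    \<open>\<mu>\<close> = -1 it would anticommute as well.\<close>
  have br: "?X1 ** ?X3 - ?X3 ** ?X1 = - ?X2"
    by (simp add: vec_eq_iff forall_5 matrix_matrix_mult_def sum_5 Xmat_nth axis_def)
  have XX: "A ** (Xmat x ** Xmat y) = Xmat x ** Xmat y ** A" for x y
  proof -
    have "A ** (Xmat x ** Xmat y) = A ** Xmat x ** Xmat y"
      by (simp only: matrix_mul_assoc)
    also have "\<dots> = \<mu> *\<^sub>R (Xmat x ** (A ** Xmat y))"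
      by (simp only: X[of x] matrix_mult_lmul matrix_mul_assoc)
    also have "\<dots> = (\<mu> * \<mu>) *\<^sub>R (Xmat x ** Xmat y ** A)"
      by (simp add: X matrix_mult_rmul matrix_mul_assoc)
    finally show ?thesis using \<mu> by auto
  qed
  have "A ** (?X1 ** ?X3 - ?X3 ** ?X1) = (?X1 ** ?X3 - ?X3 ** ?X1) ** A"
    by (simp add: matrix_mult_rsub matrix_mult_lsub XX)
  then have X2: "A ** ?X2 = ?X2 ** A"
    unfolding br by (simp add: matrix_mult_rneg matrix_mult_lneg)
  have "\<mu> = 1"
  proof (rule ccontr)
    assume "\<mu> \<noteq> 1"
    then have "A ** ?X2 = - (A ** ?X2)" using X[of "axis 2 1"] X2 \<mu> by simp
    then have "A ** ?X2 = 0" by (simp add: vec_eq_iff)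
    then have "A' ** (A ** ?X2) = 0" by (simp add: matrix_mult_rzero)
    then have "?X2 $ 1 $ 1 = 0" by (simp add: matrix_mul_assoc inv)
    then show False by (simp add: Xmat_nth axis_def)
  qed
  then have X1: "A ** ?X1 = ?X1 ** A" using X by simp
  \<comment> \<open>The diagonal matrix \<open>?X2\<close> has the distinct entries 2, 1, 0, -1, -2,
    so whatever commutes with it is diagonal.\<close>
  have off: "A$i$j = 0" if "i \<noteq> j" for i j
  proof -
    define d where "d k = ?X2 $ k $ k" for k
    have D: "?X2 $ k $ l = (if k = l then d l else 0)" for k l
      using exhaust_5[of k] by (elim disjE) (auto simp: d_def Xmat_nth axis_def)
    have "d i \<noteq> d j"
      using that exhaust_5[of i] exhaust_5[of j] by (elim disjE) (simp_all add: d_def Xmat_nth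
          axis_def)
    moreover have "A$i$k * ?X2 $ k $ j = (if k = j then A$i$j * d j else 0)"
      "?X2 $ i $ k * A$k$j = (if k = i then d i * A$i$j else 0)" for k
      using D[of k j] D[of i k] by auto
    then have "A$i$j * d j = d i * A$i$j"
      using arg_cong[OF X2, of "\<lambda>Y. Y$i$j"] by (simp add: matrix_matrix_mult_def)
    ultimately show ?thesis by simp
  qed
  \<comment> \<open>All superdiagonal entries of \<open>?X1\<close> are nonzero, so commuting with
    it equates neighbouring diagonal entries of \<open>A\<close>.\<close>
  have diag: "A$2$2 = A$1$1" "A$3$3 = A$1$1" "A$4$4 = A$1$1" "A$5$5 = A$1$1"
    using arg_cong[OF X1, of "\<lambda>Y. Y$1$2"] arg_cong[OF X1, of "\<lambda>Y. Y$2$3"]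
      arg_cong[OF X1, of "\<lambda>Y. Y$3$4"] arg_cong[OF X1, of "\<lambda>Y. Y$4$5"]
    by (simp_all add: matrix_matrix_mult_def sum_5 Xmat_nth axis_def)
  have "A = (A$1$1) *\<^sub>R mat 1"
    using diag by (simp add: vec_eq_iff mat_def forall_5 off)
  then show ?thesis by blast
qed

text \<open>Conjugation by \<open>A\<close> multiplies \<open>a ** Jmat\<close> by a scalar up to an
  error in sl2, and subtracting the projection to sl2 removes that error.\<close>

lemma Mmat_conj:
  assumes "conj_mat A a = \<epsilon> *\<^sub>R a + wmat w"
  shows "\<exists>\<mu>. A ** Mmat a = \<mu> *\<^sub>R (Mmat a ** A)"
proof -
  define \<mu> where "\<mu> = \<epsilon> / scale"
  have aJ: "A ** (a ** Jmat) = (\<mu> *\<^sub>R (a ** Jmat) + Xmat ((1/scale) *\<^sub>R w)) ** A"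
    unfolding mult_Jmat assms \<mu>_def linear_cmul[OF linear_Xmat]
    by (simp add: Xmat_def matrix_mult_ladd matrix_mult_lmul scaleR_add_right)
  have g: "g (Pvec (a ** Jmat)) = \<mu> *\<^sub>R Pvec (a ** Jmat) + (1/scale) *\<^sub>R w"
    unfolding Pvec_conj[OF aJ, symmetric]
    by (simp add: linear_add[OF linear_Pvec] linear_cmul[OF linear_Pvec] Pvec_Xmat
      linear_cmul[OF linear_Xmat])
  have "A ** Mmat a = \<mu> *\<^sub>R (Mmat a ** A)"
    unfolding Mmat_def matrix_mult_rsub mult_Xmat aJ g
    by (simp add: matrix_mult_ladd matrix_mult_lsub matrix_mult_lmul linear_add[OF linear_Xmat]
      linear_cmul[OF linear_Xmat] algebra_simps)
  then show ?thesis by blast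
qed

text \<open>A scalar \<open>s\<close> acts on the exterior square by its square, which must equal
  \<open>\<epsilon>\<close>: otherwise \<open>a\<close> would lie in \<open>W\<close> and all
  covariants would vanish.\<close>

theorem generic_stabilizer:
  assumes conj: "conj_mat A a = \<epsilon> *\<^sub>R a + wmat w" and \<epsilon>: "\<bar>\<epsilon>\<bar> = 1" and gen: "generic (Mmat a) \<noteq> 0"
  shows "A = mat 1 \<or> A = - mat 1"
proof -
  obtain s where s: "A = s *\<^sub>R mat 1"
    using Mmat_conj[OF conj] scalar_of_generic[OF _ gen] by blast
  have "s^2 = \<epsilon>"
  proof (rule ccontr)
    assume ne: "s^2 \<noteq> \<epsilon>"
    have "conj_mat A a = s^2 *\<^sub>R a"
      by (simp add: s conj_mat_def matrix_mult_lmul matrix_mult_rmul transpose_scalar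
          transpose_mat power2_eq_square)
    then have "(s^2 - \<epsilon>) *\<^sub>R a = wmat w" using conj by (simp add: algebra_simps)
    then have "a = wmat ((1 / (s^2 - \<epsilon>)) *\<^sub>R w)" using ne
      by (simp add: linear_cmul[OF linear_wmat] flip: \<open>_ = wmat w\<close>)
    then have "Mmat a = 0" by (simp add: Mmat_def Pvec_Xmat flip: Xmat_def)
    then have "cov1 (Mmat a) = 0"
      by (simp add: cov1_def matrix_mult_lzero linear_0[OF linear_Pvec])
    then show False using gen by (simp add: generic_def qform_def)
  qed
  then have "\<bar>s\<bar>^2 = 1" using \<epsilon> by (metis abs_power2 power2_abs)
  then have "s = 1 \<or> s = -1" by (auto simp: power2_eq_1_iff)
  then show ?thesis using s by auto
qed

end

section \<open>A point where \<open>generic\<close> does not vanish\<close>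

definition sample :: "real^5^5" where "sample = skew_unit 1 3 + skew_unit 2 5"

lemma Pvec_nth:
  "Pvec Y $ 1 = - (2 * Y$1$2 + Y$2$3 + 3 * Y$3$4 + Y$4$5) / 10"
  "Pvec Y $ 2 = (2 * Y$1$1 + Y$2$2 - Y$4$4 - 2 * Y$5$5) / 10"
  "Pvec Y $ 3 = (Y$2$1 + 3 * Y$3$2 + Y$4$3 + 2 * Y$5$4) / 10"
  by (simp_all add: Pvec_def trace_def matrix_matrix_mult_def sum_5 Xmat_nth axis_def field_simps)

lemma Mmat_add_wmat: "Mmat (a + wmat x) = Mmat a"
  by (simp add: Mmat_def matrix_mult_ladd linear_add[OF linear_Pvec] linear_add[OF linear_Xmat]
      Pvec_Xmat flip: Xmat_def)

lemma Mmat_sample: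
  "Mmat sample $ 1 = 3 *\<^sub>R axis 3 1" "Mmat sample $ 2 = (6/5) *\<^sub>R axis 1 1"
  "Mmat sample $ 3 = (- 2/5) *\<^sub>R axis 2 1 - 2 *\<^sub>R axis 5 1" "Mmat sample $ 4 = (- 6/5) *\<^sub>R axis 3 1"
  "Mmat sample $ 5 = (3/5) *\<^sub>R axis 4 1"
  by (simp_all add: vec_eq_iff forall_5 Mmat_def Pvec_nth Xmat_nth matrix_matrix_mult_def sum_5
      sample_def skew_unit_def Jmat_def axis_def)

text \<open>For the grading by \<open>Xmat (axis 2 1)\<close>, all entries of
  \<open>Mmat sample\<close> have weight 2 or -1, both 2 modulo 3. Covariants of degrees 3, 5, 7
  thus have weights 0, 1, -1 modulo 3 and lie on three different coordinate axes.\<close>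

lemma generic_sample: "generic (Mmat (sample + wmat x)) \<noteq> 0"
proof -
  let ?M = "Mmat sample"
  have mult: "(?M ** Y) $ 1 = 3 *\<^sub>R Y $ 3" "(?M ** Y) $ 2 = (6/5) *\<^sub>R Y $ 1"
    "(?M ** Y) $ 3 = (- 2/5) *\<^sub>R Y $ 2 - 2 *\<^sub>R Y $ 5" "(?M ** Y) $ 4 = (- 6/5) *\<^sub>R Y $ 3"
    "(?M ** Y) $ 5 = (3/5) *\<^sub>R Y $ 4" for Y
    by (simp_all add: vec_eq_iff forall_5 matrix_matrix_mult_def sum_5 Mmat_sample axis_def)
  have 1: "cov1 ?M $ 1 = 0" "cov1 ?M $ 2 = - 108/125" "cov1 ?M $ 3 = 0"
    by (simp_all add: cov1_def Pvec_nth mult Mmat_sample axis_def flip: matrix_mul_assoc)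
  have 2: "cov2 ?M $ 1 = 3888/3125" "cov2 ?M $ 2 = 0" "cov2 ?M $ 3 = 0"
    by (simp_all add: cov2_def Pvec_nth mult matrix_matrix_mult_def[of "Xmat _"] sum_5 Mmat_sample
      Xmat_nth 1 axis_def flip: matrix_mul_assoc)
  have 3: "cov3 ?M $ 1 = 0" "cov3 ?M $ 2 = 0" "cov3 ?M $ 3 = - 279936/390625"
    by (simp_all add: cov3_def Pvec_nth mult matrix_matrix_mult_def[of "Xmat _"] sum_5 Mmat_sample
      Xmat_nth 2 axis_def flip: matrix_mul_assoc)
  show ?thesis
    by (simp add: Mmat_add_wmat generic_def qform_def det_3 1 2 3)
qed

section \<open>Automorphisms of \<open>G'\<close>\<close>

lemma W_iff: "a \<in> W \<longleftrightarrow> (\<exists>x. mat_of a = wmat x)"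
proof -
  have skew_unit: "mat_of (\<sigma> i \<and>\<^sub>V \<sigma> j) = skew_unit i j" for i j
    by (auto simp: wedge.rep_eq skew_unit_def axis_def vec_eq_iff)
  have "a \<in> W \<longleftrightarrow> (\<exists>p q r. a = p *\<^sub>R (\<sigma> 1 \<and>\<^sub>V \<sigma> 4 - \<sigma> 2 \<and>\<^sub>V \<sigma> 3)
      + q *\<^sub>R (\<sigma> 1 \<and>\<^sub>V \<sigma> 5 - \<sigma> 2 \<and>\<^sub>V \<sigma> 4) + r *\<^sub>R (\<sigma> 2 \<and>\<^sub>V \<sigma> 5 - \<sigma> 3 \<and>\<^sub>V \<sigma> 4))"
    unfolding W_def by (auto simp: span_insert algebra_simps)
  also have "\<dots> \<longleftrightarrow> (\<exists>p q r. mat_of a = wmat (vector [p, q, r]))"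
    by (simp add: wmat_def skew_unit plus_wedge2.rep_eq minus_wedge2.rep_eq scaleR_wedge2.rep_eq
        flip: mat_of_inject)
  also have "\<dots> \<longleftrightarrow> (\<exists>x. mat_of a = wmat x)"
    using forall_vector_3[of "\<lambda>x. mat_of a \<noteq> wmat x"] by blast
  finally show ?thesis .
qed

lift_definition ext2 :: "real^5^5 \<Rightarrow> wedge2 \<Rightarrow> wedge2" is conj_mat
  by (rule conj_mat_skew)

lemma linear_ext2: "linear (ext2 M)"
  by (rule linearI; transfer) (simp_all add: conj_mat_def matrix_mult_ladd matrix_mult_radd
      matrix_mult_lmul matrix_mult_rmul)

lemma ext2_wedge: "ext2 M (v \<and>\<^sub>V w) = (M *v v) \<and>\<^sub>V (M *v w)"
proof (transfer, simp only: vec_eq_iff, intro allI)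
  fix M :: "real^5^5" and v w :: "real^5" and i j
  have "conj_mat M (\<chi> i j. v$i * w$j - v$j * w$i) $ i $ j =
      (\<Sum>k\<in>UNIV. \<Sum>l\<in>UNIV. (M$i$k * v$k) * (M$j$l * w$l)) - (\<Sum>k\<in>UNIV. \<Sum>l\<in>UNIV. (M$i$k * w$k) *
          (M$j$l * v$l))"
    by (simp add: conj_mat_nth algebra_simps sum_subtractf)
  also have "\<dots> = (M *v v)$i * (M *v w)$j - (M *v w)$i * (M *v v)$j"
    by (simp only: matrix_vector_mult_def vec_lambda_beta sum_product)
  finally show "conj_mat M (\<chi> i j. v$i * w$j - v$j * w$i) $ i $ j =
      (\<chi> i j. (M *v v)$i * (M *v w)$j - (M *v v)$j * (M *v w)$i) $ i $ j"
    by (simp add: mult.commute)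
qed

lemma ext2_mult: "ext2 (M ** N) a = ext2 M (ext2 N a)"
  by transfer (rule conj_mat_mult)

lemma ext2_id: "ext2 (mat 1) a = a"
  by transfer (simp add: conj_mat_def)

section \<open>The group \<open>G'\<close> in coordinates\<close>

locale central_quotient = fixes t :: Vprime
begin

definition cls :: "lie_alg \<Rightarrow> lie_alg set" where "cls a = Theta (0, t) #>\<^bsub>G\<^esub> a"

lemma in_derived: "(0, t) \<in> derived G (carrier G)"
  unfolding derived_G by simp

lemmas carrier_eq = carrier_G'[OF in_derived, folded cls_def]
  and cls_mult = coset_mult[OF in_derived, folded cls_def]
  and group' = group_G'[OF in_derived]
  and quotient_map_cls = quotient_map_G'[OF in_derived, folded cls_def]
  and D'_range = D'_eq[OF in_derived, folded cls_def]
  and V_coset_range = V_coset_eq[OF in_derived, folded cls_def]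

lemma cls_in_carrier [simp]: "cls a \<in> carrier (G' (0, t))"
  by (simp add: carrier_eq)

lemma Theta_eq: "Theta (0, t) = range (\<lambda>n::int. (0, real_of_int n *\<^sub>R t))"
proof -
  have nat: "(0, t) [^]\<^bsub>G\<^esub> (n::nat) = (0, real n *\<^sub>R t)" for n
    by (induction n) (simp_all add: zero_prod_def lie_bracket_def wedge_self linear_0[OF
        linear_modW] algebra_simps)
  have "(0, t) [^]\<^bsub>G\<^esub> (k::int) = (0, real_of_int k *\<^sub>R t)" for k
    by (auto simp: int_pow_def2 nat inv_G)
  then show ?thesis
    unfolding Theta_def by (subst group.generate_pow[OF group_G]) auto
qed

lemma cls_eq: "cls (v, x) = range (\<lambda>n::int. (v, x + real_of_int n *\<^sub>R t))"
  unfolding cls_def coset_eq[OF in_derived] by (simp add: Theta_eq image_image add.commute)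

lemma cls_eq_iff: "cls (v, x) = cls (w, y) \<longleftrightarrow> v = w \<and> (\<exists>n::int. y = x + real_of_int n *\<^sub>R t)"
proof
  assume "cls (v, x) = cls (w, y)"
  moreover have "(w, y) \<in> cls (w, y)" unfolding cls_eq by (auto intro: range_eqI[of _ _ 0])
  ultimately have "(w, y) \<in> cls (v, x)" by simp
  then show "v = w \<and> (\<exists>n::int. y = x + real_of_int n *\<^sub>R t)" by (auto simp: cls_eq)
next
  assume "v = w \<and> (\<exists>n::int. y = x + real_of_int n *\<^sub>R t)"
  then obtain n where n: "v = w" "y = x + real_of_int n *\<^sub>R t" by blast
  have "cls (w, y) = range ((\<lambda>m::int. (v, x + real_of_int m *\<^sub>R t)) \<circ> (\<lambda>m. n + m))"
    unfolding cls_eq by (simp add: n o_def algebra_simps)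
  also have "\<dots> = cls (v, x)"
    unfolding cls_eq image_comp[symmetric] surj_plus ..
  finally show "cls (v, x) = cls (w, y)" ..
qed

lemma carrier_cases:
  assumes "C \<in> carrier (G' (0, t))" obtains v x where "C = cls (v, x)"
  using assms by (auto simp: carrier_eq)

definition vpart :: "lie_alg set \<Rightarrow> real^5" where "vpart C = (THE v. \<exists>x. C = cls (v, x))"

lemma vpart_cls [simp]: "vpart (cls (v, x)) = v"
  unfolding vpart_def by (rule the_equality) (auto simp: cls_eq_iff)

lemma vpart_mult:
  "C \<in> carrier (G' (0, t)) \<Longrightarrow> D \<in> carrier (G' (0, t)) \<Longrightarrow> vpart (C \<otimes>\<^bsub>G' (0, t)\<^esub> D) = vpart C + vpart D"
  by (auto elim!: carrier_cases simp: cls_mult lie_bracket_def)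

lemma continuous_vpart: "continuous_map (top_G' (0, t)) euclidean vpart"
proof (rule continuous_compose_quotient_map[OF quotient_map_cls])
  have "vpart \<circ> cls = fst" by (auto simp: fun_eq_iff)
  then show "continuous_map euclidean euclidean (vpart \<circ> cls)"
    by (simp add: continuous_on_fst continuous_map_iff_continuous2 continuous_on_id)
qed

text \<open>Homomorphisms map the commutator subgroup into itself.\<close>

lemma hom_D':
  assumes "\<tau> \<in> hom (G' (0, t)) (G' (0, t))"
  shows "vpart (\<tau> (cls (0, x))) = 0"
proof -
  interpret group_hom "G' (0, t)" "G' (0, t)" \<tau>
    using assms group' by (simp add: group_hom_def group_hom_axioms_def)
  have "\<tau> ` D' (0, t) = derived (G' (0, t)) (\<tau> ` carrier (G' (0, t)))"
    unfolding D'_def by (rule derived_img[symmetric]) simp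
  also have "\<dots> \<subseteq> D' (0, t)"
    unfolding D'_def by (rule mono_derived) (use assms in \<open>auto simp: hom_def\<close>)
  finally have "\<tau> (cls (0, x)) \<in> range (\<lambda>x. cls (0, x))" unfolding D'_range by blast
  then show ?thesis by auto
qed

lemma hom_vpart:
  assumes "\<tau> \<in> hom (G' (0, t)) (G' (0, t))"
  shows "vpart (\<tau> (cls (v, x))) = vpart (\<tau> (cls (v, 0)))"
proof -
  have "cls (v, x) = cls (v, 0) \<otimes>\<^bsub>G' (0, t)\<^esub> cls (0, x)"
    by (simp add: cls_mult G_mult_central del: G_simps)
  then have "\<tau> (cls (v, x)) = \<tau> (cls (v, 0)) \<otimes>\<^bsub>G' (0, t)\<^esub> \<tau> (cls (0, x))"
    using assms by (simp add: hom_mult)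
  then show ?thesis
    using assms by (simp add: vpart_mult hom_in_carrier hom_D'[OF assms])
qed

section \<open>The factor of an endomorphism\<close>

lemma linear_factor:
  assumes hom: "\<tau> \<in> hom (G' (0, t)) (G' (0, t))"
    and cont: "continuous_map (top_G' (0, t)) (top_G' (0, t)) \<tau>"
  obtains A where "linear A" "\<And>v x. vpart (\<tau> (cls (v, x))) = A v"
proof
  let ?A = "\<lambda>v. vpart (\<tau> (cls (v, 0)))"
  show "vpart (\<tau> (cls (v, x))) = ?A v" for v x by (rule hom_vpart[OF hom])
  show "linear ?A"
  proof (rule linear_of_continuous_additive)
    fix v w
    have "\<tau> (cls (v, 0) \<otimes>\<^bsub>G' (0, t)\<^esub> cls (w, 0)) = \<tau> (cls (v, 0)) \<otimes>\<^bsub>G' (0, t)\<^esub> \<tau> (cls (w, 0))"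
      using hom by (simp add: hom_mult)
    then have "?A v + ?A w = vpart (\<tau> (cls (v, 0) \<otimes>\<^bsub>G' (0, t)\<^esub> cls (w, 0)))"
      using hom by (simp add: vpart_mult hom_in_carrier)
    also have "\<dots> = ?A (v + w)"
      by (simp add: cls_mult lie_bracket_def) (rule hom_vpart[OF hom])
    finally show "?A (v + w) = ?A v + ?A w" ..
  next
    have "continuous_map euclidean euclidean (\<lambda>v::real^5. (v, 0::Vprime))"
      by (simp add: continuous_map_iff_continuous2 continuous_on_Pair continuous_on_id
          continuous_on_const)
    then have "continuous_map euclidean euclidean (vpart \<circ> (\<tau> \<circ> (cls \<circ> (\<lambda>v. (v, 0)))))"
      by (intro continuous_map_compose[OF _ continuous_vpart] continuous_map_compose[OF _ cont]
          continuous_map_compose[OF _ quotient_imp_continuous_map[OF quotient_map_cls]])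
    then show "continuous_on UNIV ?A" by (simp add: o_def)
  qed
qed

text \<open>In \<open>G\<close> one has \<open>ab = [a, b]ba\<close>, so \<open>\<tau>\<close> is determined on brackets by the factor \<open>A\<close>.\<close>

lemma hom_central:
  assumes hom: "\<tau> \<in> hom (G' (0, t)) (G' (0, t))" and A: "linear A" "\<And>v x. vpart (\<tau> (cls (v, x))) =
      A v"
  shows "\<tau> (cls (0, modW a)) = cls (0, modW (ext2 (matrix A) a))"
proof -
  interpret G: group "G' (0, t)" by (rule group')
  define P where "P a \<longleftrightarrow> \<tau> (cls (0, modW a)) = cls (0, modW (ext2 (matrix A) a))" for a
  have cls_add: "cls (0, x + y) = cls (0, x) \<otimes>\<^bsub>G' (0, t)\<^esub> cls (0, y)" for x y
    by (simp add: cls_mult G_mult_central add.commute del: G_simps)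
  have add: "P (a + b)" if "P a" "P b" for a b
    using that hom by (simp add: P_def linear_add[OF linear_modW] linear_add[OF linear_ext2]
        cls_add hom_mult)
  have wedge: "P (v \<and>\<^sub>V w)" for v w
  proof -
    have swap: "cls a \<otimes>\<^bsub>G' (0, t)\<^esub> cls b =
        cls (lie_bracket a b) \<otimes>\<^bsub>G' (0, t)\<^esub> (cls b \<otimes>\<^bsub>G' (0, t)\<^esub> cls a)" for a b
    proof -
      have "(1/2) *\<^sub>R z = z + (1/2) *\<^sub>R (- z)" for z :: Vprime
        by (simp add: algebra_simps flip: scaleR_left_distrib)
      then have "a \<otimes>\<^bsub>G\<^esub> b = lie_bracket a b \<otimes>\<^bsub>G\<^esub> (b \<otimes>\<^bsub>G\<^esub> a)"
        using wedge_swap[of "fst b" "fst a"]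
        by (simp add: lie_bracket_def prod_eq_iff bilinear_lzero[OF bilinear_wedge]
          linear_0[OF linear_modW] linear_neg[OF linear_modW])
      then show ?thesis by (simp only: cls_mult)
    qed
    have "\<tau> (cls (v, 0)) \<in> carrier (G' (0, t))" "\<tau> (cls (w, 0)) \<in> carrier (G' (0, t))"
      using hom by (simp_all add: hom_in_carrier)
    then obtain x y where x: "\<tau> (cls (v, 0)) = cls (A v, x)" and y: "\<tau> (cls (w, 0)) = cls (A w, y)"
      using A(2) by (metis carrier_cases vpart_cls)
    have "cls (A v, x) \<otimes>\<^bsub>G' (0, t)\<^esub> cls (A w, y) = \<tau> (cls (v, 0) \<otimes>\<^bsub>G' (0, t)\<^esub> cls (w, 0))"
      using hom by (simp add: hom_mult x y)
    also have "\<dots> = \<tau> (cls (lie_bracket (v, 0) (w, 0))) \<otimes>\<^bsub>G' (0, t)\<^esub>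
        (cls (A w, y) \<otimes>\<^bsub>G' (0, t)\<^esub> cls (A v, x))"
      unfolding swap[of "(v, 0)"] using hom by (simp add: hom_mult x y)
    finally have "\<tau> (cls (lie_bracket (v, 0) (w, 0))) = cls (lie_bracket (A v, x) (A w, y))"
      unfolding swap[of "(A v, x)"]
      by (subst (asm) G.right_cancel) (use hom in \<open>simp_all add: hom_in_carrier\<close>)
    then show ?thesis
      by (simp add: P_def lie_bracket_def ext2_wedge matrix_works A(1))
  qed
  have zero: "P 0" using wedge[of 0 0] by (simp add: wedge_self)
  have sum: "P (\<Sum>i\<in>I. h i)" if "finite I" "\<And>i. i \<in> I \<Longrightarrow> P (h i)" for I :: "5 set" and h
    using that by induction (auto intro: add zero)
  \<comment> \<open>So far \<open>P\<close> is only additive, so scalars are absorbed into one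
    factor of the wedge.\<close>
  have "r *\<^sub>R (v \<and>\<^sub>V w) = (r *\<^sub>R v) \<and>\<^sub>V w" for r v w
    by (simp add: bilinear_lmul[OF bilinear_wedge])
  then have "P (\<Sum>i\<in>UNIV. \<Sum>j\<in>UNIV. (mat_of a $ i $ j / 2) *\<^sub>R (\<sigma> i \<and>\<^sub>V \<sigma> j))"
    by (auto intro!: sum wedge)
  then have "P a" by (simp flip: wedge2_expand)
  then show ?thesis by (simp add: P_def)
qed

text \<open>A homomorphism kills the whole line through \<open>a \<in> W\<close>, and a discrete group contains no line.\<close>

lemma ext2_W:
  assumes hom: "\<tau> \<in> hom (G' (0, t)) (G' (0, t))" and A: "linear A" "\<And>v x. vpart (\<tau> (cls (v, x))) =
      A v"
    and a: "a \<in> W"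
  shows "ext2 (matrix A) a \<in> W"
proof (rule ccontr)
  define y where "y = modW (ext2 (matrix A) a)"
  assume "ext2 (matrix A) a \<notin> W"
  then have y: "y \<noteq> 0" by (simp add: y_def modW_eq_0_iff)
  have "\<exists>n::int. r *\<^sub>R y = real_of_int n *\<^sub>R t" for r
  proof -
    have 1: "modW (r *\<^sub>R a) = modW 0"
      using a subspace_scale[OF subspace_W] by (simp add: modW_eq_iff)
    have "cls (0, modW (ext2 (matrix A) 0)) = cls (0, modW (ext2 (matrix A) (r *\<^sub>R a)))"
      using hom_central[OF hom A, of "r *\<^sub>R a"] hom_central[OF hom A, of 0] unfolding 1 by simp
    then show ?thesis
      by (simp add: cls_eq_iff linear_0[OF linear_ext2] linear_0[OF linear_modW] y_def
         linear_cmul[OF linear_ext2] linear_cmul[OF linear_modW])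
  qed
  note * = this
  obtain n where n: "y = real_of_int n *\<^sub>R t" using *[of 1] by auto
  \<comment> \<open>This parameter would make half of \<open>t\<close> an integer multiple of
    \<open>t\<close>.\<close>
  obtain m where m: "(1 / (2 * real_of_int n)) *\<^sub>R y = real_of_int m *\<^sub>R t" using * by blast
  have "n \<noteq> 0" "t \<noteq> 0" using n y by auto
  then have "(1/2) *\<^sub>R t = real_of_int m *\<^sub>R t" using m by (simp add: n)
  then have "1 = 2 * real_of_int m" using \<open>t \<noteq> 0\<close> by simp
  then have "1 = 2 * m" by linarith
  then show False by presburger
qed

text \<open>The class of \<open>t\<close> is the identity of \<open>G'\<close>, so its image is the
  identity too and lies in the cyclic group generated by \<open>t\<close>.\<close>

lemma ext2_t:
  assumes hom: "\<tau> \<in> hom (G' (0, t)) (G' (0, t))" and A: "linear A" "\<And>v x. vpart (\<tau> (cls (v, x))) =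
      A v"
    and a: "modW a = t"
  shows "\<exists>n::int. modW (ext2 (matrix A) a) = real_of_int n *\<^sub>R t"
proof -
  have "cls (0, modW 0) = cls (0, modW a)"
    by (auto simp: cls_eq_iff a linear_0[OF linear_modW] intro: exI[of _ 1])
  then have "cls (0, modW (ext2 (matrix A) 0)) = cls (0, modW (ext2 (matrix A) a))"
    by (metis hom_central[OF hom A])
  then show ?thesis by (simp add: cls_eq_iff linear_0[OF linear_ext2] linear_0[OF linear_modW])
qed

lemma Aut_D:
  assumes "\<tau> \<in> carrier (Aut_G' (0, t))"
  shows "\<tau> \<in> hom (G' (0, t)) (G' (0, t))" "bij_betw \<tau> (carrier (G' (0, t))) (carrier (G' (0, t)))"
    "continuous_map (top_G' (0, t)) (top_G' (0, t)) \<tau>"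
  using assms by (auto simp: Aut_G'_def auto_def Bij_def)

lemma has_factor_of_generic:
  assumes \<tau>: "\<tau> \<in> carrier (Aut_G' (0, t))" and gen: "generic (Mmat (mat_of (orth_rep t))) \<noteq> 0"
  shows "has_factor (0, t) \<tau> (\<lambda>v. v) \<or> has_factor (0, t) \<tau> (\<lambda>v. - v)"
proof -
  interpret G: group "G' (0, t)" by (rule group')
  note hom = Aut_D(1)[OF \<tau>] and bij = Aut_D(2)[OF \<tau>]
  obtain A where A: "linear A" "\<And>v x. vpart (\<tau> (cls (v, x))) = A v"
    by (rule linear_factor[OF hom Aut_D(3)[OF \<tau>]]) (rule that)
  have onto: "\<exists>u z. cls (w, y) = \<tau> (cls (u, z)) \<and> w = A u" for w y
  proof -
    have "cls (w, y) \<in> \<tau> ` carrier (G' (0, t))" using bij by (simp add: bij_betw_def)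
    then obtain C where C: "cls (w, y) = \<tau> C" "C \<in> carrier (G' (0, t))" by (rule imageE)
    from C(2) obtain u z where uz: "C = cls (u, z)" by (rule carrier_cases)
    have "w = A u" using A(2)[of u z] by (simp flip: uz C(1))
    then show ?thesis using C(1) uz by blast
  qed
  then have "surj A" by (metis surj_def)
  then obtain B where B: "linear B" "A \<circ> B = id"
    using linear_surjective_right_inverse[OF A(1)] by blast
  then have BA: "B \<circ> A = id" using linear_inverse_left[OF A(1)] by blast
  \<comment> \<open>The inverse homomorphism shows that \<open>B\<close> preserves \<open>W\<close>
    as well, and it supplies an integer inverse to \<open>n\<close>.\<close>
  define \<rho> where "\<rho> = inv_into (carrier (G' (0, t))) \<tau>"
  have "\<rho> \<in> Group.iso (G' (0, t)) (G' (0, t))"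
    unfolding \<rho>_def using hom bij by (intro G.iso_set_sym) (simp add: iso_def)
  then have hom': "\<rho> \<in> hom (G' (0, t)) (G' (0, t))" by (simp add: iso_def)
  have B': "vpart (\<rho> (cls (v, x))) = B v" for v x
  proof -
    obtain u z where u: "cls (v, x) = \<tau> (cls (u, z))" "v = A u" using onto by blast
    have "\<rho> (cls (v, x)) = cls (u, z)"
      unfolding \<rho>_def u(1) using bij by (intro inv_into_f_f) (simp_all add: bij_betw_def)
    then show ?thesis using u(2) fun_cong[OF BA, of u] by simp
  qed
  define M N where "M = matrix A" and "N = matrix B"
  have MN: "M ** N = mat 1" "N ** M = mat 1"
    unfolding M_def N_def using A(1) B BA by (simp_all add: matrix_id_mat_1 flip: matrix_compose)
  define f where "f x = (SOME y. conj_mat M (wmat x) = wmat y)" for x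
  define f' where "f' x = (SOME y. conj_mat N (wmat x) = wmat y)" for x
  have ex: "\<exists>y. conj_mat K (wmat x) = wmat y" if K: "\<And>a. a \<in> W \<Longrightarrow> ext2 K a \<in> W" for K x
  proof -
    have "mat_of (Abs_wedge2 (wmat x)) = wmat x" by (rule Abs_wedge2_inverse) (simp add: wmat_skew)
    then show ?thesis using K[of "Abs_wedge2 (wmat x)"] by (metis W_iff ext2.rep_eq)
  qed
  interpret S: W_stabilizer M N f f'
  proof
    show "M ** N = mat 1" "N ** M = mat 1" by (rule MN)+
    show "conj_mat M (wmat x) = wmat (f x)" for x
      unfolding f_def by (rule someI_ex, rule ex) (simp add: M_def ext2_W[OF hom A])
    show "conj_mat N (wmat x) = wmat (f' x)" for x
      unfolding f'_def by (rule someI_ex, rule ex) (simp add: N_def ext2_W[OF hom' B(1) B'])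
  qed
  define a where "a = orth_rep t"
  have a: "modW a = t" by (simp add: a_def modW_orth_rep)
  have "t \<noteq> 0"
  proof
    assume "t = 0"
    then have "Mmat (mat_of a) = Mmat (0 + wmat 0)"
      by (simp add: a_def orth_rep_zero zero_wedge2.rep_eq linear_0[OF linear_wmat])
    also have "\<dots> = 0"
      by (simp add: Mmat_def matrix_mult_lzero linear_0[OF linear_Pvec] linear_0[OF linear_Xmat]
         linear_0[OF linear_wmat])
    finally show False using gen
      by (simp add: a_def generic_def cov1_def matrix_mult_lzero linear_0[OF linear_Pvec] qform_def)
  qed
  obtain n :: int where n: "modW (ext2 M a) = real_of_int n *\<^sub>R t"
    unfolding M_def using ext2_t[OF hom A a] by blast
  obtain m :: int where m: "modW (ext2 N a) = real_of_int m *\<^sub>R t"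
    unfolding N_def using ext2_t[OF hom' B(1) B' a] by blast
  \<comment> \<open>Applying \<open>M\<close> to this congruence modulo \<open>W\<close> turns the
    two integer multiples into \<open>m * n = 1\<close>.\<close>
  have "ext2 N a - real_of_int m *\<^sub>R a \<in> W"
    using m by (simp add: a linear_cmul[OF linear_modW] flip: modW_eq_iff)
  then have "ext2 M (ext2 N a - real_of_int m *\<^sub>R a) \<in> W"
    unfolding M_def by (rule ext2_W[OF hom A])
  then have "modW (ext2 M (ext2 N a)) = modW (ext2 M (real_of_int m *\<^sub>R a))"
    by (simp add: modW_eq_iff linear_diff[OF linear_ext2])
  then have "t = (real_of_int m * real_of_int n) *\<^sub>R t"
    by (simp add: MN ext2_id a n linear_cmul[OF linear_ext2] linear_cmul[OF linear_modW] flip: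
        ext2_mult)
  then have "real_of_int (m * n) = 1" using \<open>t \<noteq> 0\<close> by (metis of_int_mult scaleR_cancel_right
      scaleR_one)
  then have "m * n = 1" by linarith
  then have "\<bar>n\<bar> = 1" by (metis abs_zmult_eq_1 mult.commute abs_1)
  then have n1: "\<bar>real_of_int n\<bar> = 1" by linarith
  have "ext2 M a - real_of_int n *\<^sub>R a \<in> W"
    using n by (simp add: a linear_cmul[OF linear_modW] flip: modW_eq_iff)
  then obtain w where "mat_of (ext2 M a - real_of_int n *\<^sub>R a) = wmat w"
    unfolding W_iff by blast
  then have "conj_mat M (mat_of a) = real_of_int n *\<^sub>R mat_of a + wmat w"
    by (simp add: minus_wedge2.rep_eq ext2.rep_eq scaleR_wedge2.rep_eq algebra_simps)
  then have M: "M = mat 1 \<or> M = - mat 1"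
    using S.generic_stabilizer n1 gen unfolding a_def by blast
  have Av: "A v = M *v v" for v by (simp add: M_def matrix_works A(1))
  have "\<tau> ` V_coset (0, t) v = V_coset (0, t) (A v)" for v
  proof
    show "\<tau> ` V_coset (0, t) v \<subseteq> V_coset (0, t) (A v)"
    proof (clarsimp simp: V_coset_range)
      fix x
      have "\<tau> (cls (v, x)) \<in> carrier (G' (0, t))" using hom by (simp add: hom_in_carrier)
      then show "\<tau> (cls (v, x)) \<in> range (\<lambda>x. cls (A v, x))"
        using A(2)[of v x] by (metis carrier_cases vpart_cls rangeI)
    qed
    show "V_coset (0, t) (A v) \<subseteq> \<tau> ` V_coset (0, t) v"
    proof (clarsimp simp: V_coset_range)
      fix y
      obtain u z where u: "cls (A v, y) = \<tau> (cls (u, z))" "A v = A u" using onto by blast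
      then have "u = v" using BA by (metis comp_apply id_apply)
      then show "cls (A v, y) \<in> \<tau> ` range (\<lambda>x. cls (v, x))" using u(1) by auto
    qed
  qed
  then have "has_factor (0, t) \<tau> A" by (simp add: has_factor_def)
  moreover have "A = (\<lambda>v. v) \<or> A = (\<lambda>v. - v)"
    using M by (auto simp: fun_eq_iff Av vec_eq_iff matrix_vector_mult_def sum_negf mat_def
        if_distrib[of "\<lambda>x. x * _"] if_distrib[of uminus] cong: if_cong)
  ultimately show ?thesis by metis
qed


section \<open>Construction of automorphisms and their orbits\<close>

text \<open>Since \<open>s * s = 1\<close> the bracket is unchanged, and \<open>F\<close> takes
  central values, so the map is an automorphism of \<open>G\<close>. It fixes the centre part V'
  pointwise, hence descends to \<open>G'\<close>.\<close>

lemma lift_automorphism: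
  assumes s: "s * s = (1::real)" and F: "linear F"
  shows "\<exists>\<tau> \<in> carrier (Aut_G' (0, t)). \<forall>u z. \<tau> (cls (u, z)) = cls (s *\<^sub>R u, z + F u)"
proof -
  define \<phi> where "\<phi> a = (s *\<^sub>R fst a, snd a + F (fst a))" for a :: lie_alg
  \<comment> \<open>By \<open>\<phi>_cong\<close> the chosen representative does not matter; the
    restriction makes \<open>\<tau>\<close> extensional, as \<open>auto\<close> demands.\<close>
  define \<tau> where "\<tau> = (\<lambda>C\<in>carrier (G' (0, t)). cls (\<phi> (SOME a. cls a = C)))"
  have \<phi>_cong: "cls (\<phi> a) = cls (\<phi> b) \<longleftrightarrow> cls a = cls b" for a b
    using s by (cases a; cases b) (auto simp: \<phi>_def cls_eq_iff algebra_simps)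
  have \<tau>: "\<tau> (cls a) = cls (\<phi> a)" for a
  proof -
    have "cls (SOME b. cls b = cls a) = cls a" by (rule someI[of _ a]) simp
    then show ?thesis by (simp add: \<tau>_def \<phi>_cong)
  qed
  have \<phi>_mult: "\<phi> (a \<otimes>\<^bsub>G\<^esub> b) = \<phi> a \<otimes>\<^bsub>G\<^esub> \<phi> b" for a b
    using s by (simp add: \<phi>_def lie_bracket_def linear_add[OF F] bilinear_lmul[OF bilinear_wedge]
        bilinear_rmul[OF bilinear_wedge] linear_cmul[OF linear_modW] algebra_simps)
  have "\<phi> (s *\<^sub>R v, x - F (s *\<^sub>R v)) = (v, x)" for v x
    using s by (simp add: \<phi>_def)
  then have surj: "\<exists>a. b = \<phi> a" for b by (metis surj_pair)
  have hom: "\<tau> \<in> hom (G' (0, t)) (G' (0, t))"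
    by (auto simp: hom_def carrier_eq \<tau> cls_mult \<phi>_mult simp del: G_simps)
  have bij: "bij_betw \<tau> (carrier (G' (0, t))) (carrier (G' (0, t)))"
    unfolding bij_betw_def inj_on_def carrier_eq
  proof (intro conjI)
    show "\<forall>C\<in>range cls. \<forall>D\<in>range cls. \<tau> C = \<tau> D \<longrightarrow> C = D" by (auto simp: \<tau> \<phi>_cong)
    have "\<tau> ` range cls = cls ` range \<phi>" by (simp add: image_image \<tau>)
    also have "range \<phi> = UNIV" using surj by (metis surj_def)
    finally show "\<tau> ` range cls = range cls" .
  qed
  have "continuous_on UNIV \<phi>"
    unfolding \<phi>_def
    by (intro continuous_intros linear_continuous_on linear_compose[unfolded o_def, OF linear_fst F]
        linear_linear[THEN iffD2])
  then have "continuous_map euclidean (top_G' (0, t)) (cls \<circ> \<phi>)"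
    by (intro continuous_map_compose[OF _ quotient_imp_continuous_map[OF quotient_map_cls]])
       (simp add: continuous_map_iff_continuous2)
  moreover have "cls \<circ> \<phi> = \<tau> \<circ> cls" by (simp add: fun_eq_iff \<tau>)
  ultimately have "continuous_map (top_G' (0, t)) (top_G' (0, t)) \<tau>"
    by (intro continuous_compose_quotient_map[OF quotient_map_cls]) simp
  then have "\<tau> \<in> carrier (Aut_G' (0, t))"
    using hom bij by (simp add: Aut_G'_def auto_def Bij_def \<tau>_def)
  moreover have "\<tau> (cls (u, z)) = cls (s *\<^sub>R u, z + F u)" for u z
    by (simp add: \<tau> \<phi>_def)
  ultimately show ?thesis by blast
qed

lemma orbit_of_factors:
  assumes fac: "\<And>\<tau>. \<tau> \<in> carrier (Aut_G' (0, t)) \<Longrightarrow>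
      has_factor (0, t) \<tau> (\<lambda>v. v) \<or> has_factor (0, t) \<tau> (\<lambda>v. - v)"
    and v: "v \<noteq> 0"
  shows "orbit (Aut_G' (0, t)) (\<lambda>\<tau>. \<tau>) (cls (v, y)) = V_coset (0, t) v \<union> V_coset (0, t) (- v)"
proof (intro equalityI subsetI)
  fix C assume "C \<in> orbit (Aut_G' (0, t)) (\<lambda>\<tau>. \<tau>) (cls (v, y))"
  then obtain \<tau> where \<tau>: "\<tau> \<in> carrier (Aut_G' (0, t))" "C = \<tau> (cls (v, y))"
    by (auto simp: orbit_def)
  have "C \<in> \<tau> ` V_coset (0, t) v" unfolding \<tau>(2) V_coset_range by blast
  then show "C \<in> V_coset (0, t) v \<union> V_coset (0, t) (- v)"
    using fac[OF \<tau>(1)] unfolding has_factor_def by auto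
next
  fix C assume "C \<in> V_coset (0, t) v \<union> V_coset (0, t) (- v)"
  then obtain s :: real and x where s: "s * s = 1" and C: "C = cls (s *\<^sub>R v, x)"
    by (auto simp: V_coset_range intro: that[of 1] that[of "- 1"])
  \<comment> \<open>A linear map with \<open>F v = x - y\<close>, which exists because
    \<open>v\<close> is nonzero; it moves \<open>y\<close> to the prescribed
    \<open>x\<close>.\<close>
  define F where "F u = ((u \<bullet> v) / (v \<bullet> v)) *\<^sub>R (x - y)" for u
  have "linear F"
    by (rule linearI) (simp_all add: F_def inner_add_left add_divide_distrib scaleR_add_left)
  then obtain \<tau> where "\<tau> \<in> carrier (Aut_G' (0, t))" "\<tau> (cls (v, y)) = cls (s *\<^sub>R v, y + F v)"
    using lift_automorphism[OF s] by metis
  moreover have "y + F v = x" using v by (simp add: F_def)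
  ultimately show "C \<in> orbit (Aut_G' (0, t)) (\<lambda>\<tau>. \<tau>) (cls (v, y))"
    unfolding orbit_def C mem_Collect_eq by metis
qed

lemma orbit_cosets:
  assumes fac: "\<And>\<tau>. \<tau> \<in> carrier (Aut_G' (0, t)) \<Longrightarrow>
      has_factor (0, t) \<tau> (\<lambda>v. v) \<or> has_factor (0, t) \<tau> (\<lambda>v. - v)"
    and g: "g \<in> carrier (G' (0, t)) - D' (0, t)"
  shows "\<exists>\<C>. \<C> \<subseteq> rcosets\<^bsub>G' (0, t)\<^esub> D' (0, t) \<and> card \<C> = 2 \<and> orbit (Aut_G' (0, t)) (\<lambda>\<tau>. \<tau>) g = \<Union>\<C>"
proof -
  obtain v y where gv: "g = cls (v, y)" using g by (auto elim: carrier_cases)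
  then have v: "v \<noteq> 0" using g by (auto simp: D'_range)
  have "V_coset (0, t) u \<in> rcosets\<^bsub>G' (0, t)\<^esub> D' (0, t)" for u
    using cls_in_carrier[of "(u, 0)"] by (auto simp: V_coset_def RCOSETS_def cls_def)
  moreover have "V_coset (0, t) v \<noteq> V_coset (0, t) (- v)"
  proof
    assume "V_coset (0, t) v = V_coset (0, t) (- v)"
    then have "cls (v, 0) \<in> V_coset (0, t) (- v)" unfolding V_coset_range by blast
    then show False using v by (auto simp: V_coset_range cls_eq_iff vec_eq_iff)
  qed
  ultimately show ?thesis
    using orbit_of_factors[OF fac v, of y]
    by (intro exI[of _ "{V_coset (0, t) v, V_coset (0, t) (- v)}"]) (simp add: gv)
qed

end

section \<open>Polynomiality of \<open>generic\<close>\<close>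

lemma real_polynomial_function_matrix_mult:
  assumes "\<And>i j. real_polynomial_function (\<lambda>x. F x $ i $ j)" "\<And>i j. real_polynomial_function (\<lambda>x.
      H x $ i $ j)"
  shows "real_polynomial_function (\<lambda>x. (F x ** H x) $ i $ j)"
  unfolding matrix_matrix_mult_def vec_lambda_beta
  by (intro real_polynomial_function_sum real_polynomial_function.intros(4) assms) simp

lemma real_polynomial_function_linear:
  assumes "linear (h :: real^'n \<Rightarrow> real)" "\<And>i. real_polynomial_function (\<lambda>x. F x $ i)"
  shows "real_polynomial_function (\<lambda>x. h (F x))"
proof -
  have "h (F x) = (\<Sum>i\<in>UNIV. F x $ i * h (axis i 1))" for x
    using arg_cong[OF basis_expansion[of "F x"], of h]
    by (simp add: linear_sum[OF assms(1)] linear_cmul[OF assms(1)] scalar_mult_eq_scaleR)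
  then show ?thesis
    by (simp add: assms(2) real_polynomial_function.intros
        real_polynomial_function_sum)
qed

lemma real_polynomial_function_generic:
  fixes Y :: "'a::euclidean_space \<Rightarrow> real^5^5"
  assumes "linear Y"
  shows "real_polynomial_function (\<lambda>x. generic (Mmat (Y x)))"
proof -
  note mult = real_polynomial_function_matrix_mult
  have X: "real_polynomial_function (\<lambda>x. Xmat (F x) $ i $ j)"
    if "\<And>i. real_polynomial_function (\<lambda>x. F x $ i)" for F :: "'a \<Rightarrow> real^3" and i j
    by (rule real_polynomial_function_linear[OF _ that])
       (intro linearI; simp add: linear_add[OF linear_Xmat] linear_cmul[OF linear_Xmat])
  have P: "real_polynomial_function (\<lambda>x. Pvec (F x) $ i)"
    if "\<And>i j. real_polynomial_function (\<lambda>x. F x $ i $ j)" for F :: "'a \<Rightarrow> real^5^5" and i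
    using exhaust_3[of i]
    by (elim disjE) (simp_all add: Pvec_nth that real_polynomial_function.intros
        real_polynomial_function_minus real_polynomial_function_diff
            real_polynomial_function_divide)
  have "real_polynomial_function (\<lambda>x. (Y x ** Jmat) $ i $ j)" for i j
    by (intro real_polynomial_function.intros(1) linear_linear[THEN iffD2] linearI)
       (simp_all add: linear_add[OF assms] linear_cmul[OF assms] matrix_mult_ladd matrix_mult_lmul)
  then have M: "real_polynomial_function (\<lambda>x. Mmat (Y x) $ i $ j)" for i j
    by (simp add: Mmat_def real_polynomial_function_diff X P)
  have c1: "real_polynomial_function (\<lambda>x. cov1 (Mmat (Y x)) $ i)" for i
    unfolding cov1_def by (intro P mult M)
  have c2: "real_polynomial_function (\<lambda>x. cov2 (Mmat (Y x)) $ i)" for i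
    unfolding cov2_def by (intro P mult M X c1)
  have c3: "real_polynomial_function (\<lambda>x. cov3 (Mmat (Y x)) $ i)" for i
    unfolding cov3_def by (intro P mult M X c2)
  show ?thesis
    unfolding generic_def qform_def det_3
    by (simp add: c1 c2 c3 real_polynomial_function.intros real_polynomial_function_diff)
qed

theorem corollary5p2:
  shows "\<exists>E. E \<subseteq> derived G (carrier G) \<and> {x. (0, x) \<in> E} \<in> null_sets lebesgue \<and>
    (\<forall>\<theta> \<in> derived G (carrier G). \<theta> \<notin> E \<longrightarrow>
      (\<forall>\<tau> \<in> carrier (Aut_G' \<theta>). has_factor \<theta> \<tau> (\<lambda>v. v) \<or> has_factor \<theta> \<tau> (\<lambda>v. - v)) \<and>
      (\<forall>g \<in> carrier (G' \<theta>) - D' \<theta>.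
        \<exists>\<C>. \<C> \<subseteq> rcosets\<^bsub>G' \<theta>\<^esub> D' \<theta> \<and> (card \<C> = 1 \<or> card \<C> = 2) \<and>
            orbit (Aut_G' \<theta>) (\<lambda>\<tau>. \<tau>) g = \<Union>\<C>))"
proof -
  \<comment> \<open>Because \<open>Mmat\<close> ignores \<open>W\<close>, the value depends only on
    the class; \<open>orth_rep\<close> is a linear choice of representative, which makes
    \<open>p\<close> a polynomial.\<close>
  define p where "p x = generic (Mmat (mat_of (orth_rep x)))" for x
  define E :: "lie_alg set" where "E = {0} \<times> {x. p x = 0}"
  have "real_polynomial_function p"
    unfolding p_def using real_polynomial_function_generic[OF linear_compose[OF linear_orth_rep
        linear_mat_of]]
    by (simp add: o_def)
  moreover have "p (modW (\<sigma> 1 \<and>\<^sub>V \<sigma> 3 + \<sigma> 2 \<and>\<^sub>V \<sigma> 5)) \<noteq> 0"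
  proof -
    let ?a = "\<sigma> 1 \<and>\<^sub>V \<sigma> 3 + \<sigma> 2 \<and>\<^sub>V \<sigma> 5"
    have "mat_of ?a = sample"
      by (auto simp: sample_def plus_wedge2.rep_eq wedge.rep_eq skew_unit_def axis_def vec_eq_iff)
    \<comment> \<open>The orthogonal representative may differ from \<open>sample\<close> by an
      element of \<open>W\<close>, which \<open>generic_sample\<close> allows for.\<close>
    moreover have "orth_rep (modW ?a) - ?a \<in> W"
      using orth_rep_modW[of ?a] subspace_neg[OF subspace_W, of "?a - orth_rep (modW ?a)"] by simp
    then obtain x where "mat_of (orth_rep (modW ?a) - ?a) = wmat x" unfolding W_iff by blast
    ultimately have "mat_of (orth_rep (modW ?a)) = sample + wmat x"
      by (simp add: minus_wedge2.rep_eq algebra_simps)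
    then show ?thesis by (simp add: p_def generic_sample)
  qed
  ultimately have null: "{x. p x = 0} \<in> null_sets lebesgue"
    using negligible_zeros_polynomial by (simp add: negligible_iff_null_sets)
  have fac: "has_factor (0, t) \<tau> (\<lambda>v. v) \<or> has_factor (0, t) \<tau> (\<lambda>v. - v)"
    if "p t \<noteq> 0" "\<tau> \<in> carrier (Aut_G' (0, t))" for t \<tau>
    using central_quotient.has_factor_of_generic[OF that(2)] that(1) by (simp add: p_def)
  show ?thesis
  proof (intro exI[of _ E] conjI ballI impI)
    show "E \<subseteq> derived G (carrier G)" unfolding derived_G by (auto simp: E_def)
    show "{x. (0, x) \<in> E} \<in> null_sets lebesgue" using null by (simp add: E_def)
  next
    fix \<theta> \<tau> assume "\<theta> \<in> derived G (carrier G)" "\<theta> \<notin> E" "\<tau> \<in> carrier (Aut_G' \<theta>)"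
    then show "has_factor \<theta> \<tau> (\<lambda>v. v) \<or> has_factor \<theta> \<tau> (\<lambda>v. - v)"
      using fac unfolding derived_G E_def by auto
  next
    fix \<theta> g assume *: "\<theta> \<in> derived G (carrier G)" "\<theta> \<notin> E" "g \<in> carrier (G' \<theta>) - D' \<theta>"
    then obtain t where t: "\<theta> = (0, t)" "p t \<noteq> 0" unfolding derived_G E_def by auto
    show "\<exists>\<C>. \<C> \<subseteq> rcosets\<^bsub>G' \<theta>\<^esub> D' \<theta> \<and> (card \<C> = 1 \<or> card \<C> = 2) \<and>
            orbit (Aut_G' \<theta>) (\<lambda>\<tau>. \<tau>) g = \<Union>\<C>"
      using central_quotient.orbit_cosets[OF fac[OF t(2)]] *(3) unfolding t(1) by blast
  qed
qed

end
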